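(* Let $K$ be a field, $n>2$, $S=K[x_1,\ldots,x_n]$, and let $I\subset U$ be two monomial ideals of $S$ such that $U/I$ is a Cohen-Macaulay $S$-module of dimension $2$. Suppose that $I$ is reduced. Then $U/I$ is clean.
   Context: A monomial ideal $I$ is reduced if it is a radical ideal (equivalently, a squarefree monomial ideal). Let $M$ be a finitely generated $\mathbb Z^n$-graded $S$-module. A prime filtration of $M$ is a chain $\mathcal F: 0=M_0\subset M_1\subset\cdots\subset M_r=M$ of multigraded submodules with $M_i/M_{i-1}\cong S/P_i(-a_i)$, $a_i\in\mathbb N^n$, $P_i$ a monomial prime ideal; $\operatorname{Supp}(\mathcal F)=\{P_1,\ldots,P_r\}$. $\mathcal F$ is clean if $\operatorname{Supp}(\mathcal F)=\operatorname{Min}(M)$ (the set of minimal primes of $M$), and $M$ is clean if it has a clean filtration. *)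

theory Defs
  imports "HOL-Algebra.Algebraic_Closure_Type" "HOL-Library.Poly_Mapping" "HOL-Library.Extended_Nat" "HOL-Library.Cardinality"
begin

section \<open>Modules over a commutative ring\<close>

definition self_module :: "('a, 'c) ring_scheme \<Rightarrow> ('a, 'a) module" where
  "self_module R = \<lparr>carrier = carrier R, monoid.mult = (\<otimes>\<^bsub>R\<^esub>), one = \<one>\<^bsub>R\<^esub>,
     ring.zero = \<zero>\<^bsub>R\<^esub>, add = (\<oplus>\<^bsub>R\<^esub>), module.smult = (\<otimes>\<^bsub>R\<^esub>)\<rparr>"

text \<open>The fields \<open>mult\<close> and \<open>one\<close> of a module record carry no meaning. A submodule \<open>N\<close> of \<open>M\<close>
  is regarded as a module in the form \<open>M\<lparr>carrier := N\<rparr>\<close>.\<close>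

definition quotient_module :: "('a, 'b, 'c) module_scheme \<Rightarrow> 'b set \<Rightarrow> ('a, 'b set) module" where
  "quotient_module M N = \<lparr>carrier = a_rcosets\<^bsub>M\<^esub> N, monoid.mult = undefined, one = undefined,
     ring.zero = N, add = set_add M, module.smult = (\<lambda>r Y. \<Union>x\<in>Y. N +>\<^bsub>M\<^esub> (r \<odot>\<^bsub>M\<^esub> x))\<rparr>"

text \<open>The localization \<open>M\<^sub>P\<close> is nonzero iff \<open>x/1 \<noteq> 0\<close> for some \<open>x \<in> M\<close>, that is, iff some \<open>x\<close> is
  killed by no element outside \<open>P\<close>.\<close>

definition module_support :: "('a, 'c) ring_scheme \<Rightarrow> ('a, 'b, 'd) module_scheme \<Rightarrow> 'a set set" where
  "module_support R M = {P. primeideal P R \<and>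
     (\<exists>x\<in>carrier M. \<forall>s\<in>carrier R - P. s \<odot>\<^bsub>M\<^esub> x \<noteq> \<zero>\<^bsub>M\<^esub>)}"

definition min_primes :: "('a, 'c) ring_scheme \<Rightarrow> ('a, 'b, 'd) module_scheme \<Rightarrow> 'a set set" where
  "min_primes R M = {P \<in> module_support R M. \<forall>Q\<in>module_support R M. Q \<subseteq> P \<longrightarrow> Q = P}"

text \<open>Krull dimension of the support. The zero module gets dimension \<open>0\<close> here.\<close>

definition module_dim :: "('a, 'c) ring_scheme \<Rightarrow> ('a, 'b, 'd) module_scheme \<Rightarrow> enat" where
  "module_dim R M = Sup {enat k | k. \<exists>C :: nat \<Rightarrow> 'a set.
     (\<forall>i\<le>k. C i \<in> module_support R M) \<and> (\<forall>i<k. C i \<subset> C (Suc i))}"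

text \<open>The submodule \<open>(f\<^sub>1, \<dots>, f\<^sub>k)M\<close>.\<close>

definition seq_mult :: "('a, 'b, 'd) module_scheme \<Rightarrow> 'a list \<Rightarrow> 'b set" where
  "seq_mult M fs = {(\<Oplus>\<^bsub>M\<^esub>j\<in>{..<length fs}. fs ! j \<odot>\<^bsub>M\<^esub> x j) | x. x \<in> {..<length fs} \<rightarrow> carrier M}"

definition nonzerodivisor :: "('a, 'b, 'd) module_scheme \<Rightarrow> 'a \<Rightarrow> bool" where
  "nonzerodivisor M f \<longleftrightarrow> (\<forall>x\<in>carrier M. f \<odot>\<^bsub>M\<^esub> x = \<zero>\<^bsub>M\<^esub> \<longrightarrow> x = \<zero>\<^bsub>M\<^esub>)"

definition regular_sequence ::
    "('a, 'c) ring_scheme \<Rightarrow> ('a, 'b, 'd) module_scheme \<Rightarrow> 'a list \<Rightarrow> bool" where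
  "regular_sequence R M fs \<longleftrightarrow> set fs \<subseteq> carrier R \<and>
     (\<forall>i<length fs. nonzerodivisor (quotient_module M (seq_mult M (take i fs))) (fs ! i)) \<and>
     seq_mult M fs \<noteq> carrier M"

text \<open>Supremum of the lengths of \<open>M\<close>-regular sequences in the ideal \<open>J\<close>.\<close>

definition module_grade ::
    "('a, 'c) ring_scheme \<Rightarrow> 'a set \<Rightarrow> ('a, 'b, 'd) module_scheme \<Rightarrow> enat" where
  "module_grade R J M = Sup {enat (length fs) | fs. set fs \<subseteq> J \<and> regular_sequence R M fs}"

definition module_iso :: "('a, 'c) ring_scheme \<Rightarrow> ('a, 'b, 'd) module_scheme \<Rightarrow>
    ('a, 'e, 'f) module_scheme \<Rightarrow> ('b \<Rightarrow> 'e) set" where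
  "module_iso R M N = {h. bij_betw h (carrier M) (carrier N) \<and>
     (\<forall>x\<in>carrier M. \<forall>y\<in>carrier M. h (x \<oplus>\<^bsub>M\<^esub> y) = h x \<oplus>\<^bsub>N\<^esub> h y) \<and>
     (\<forall>r\<in>carrier R. \<forall>x\<in>carrier M. h (r \<odot>\<^bsub>M\<^esub> x) = r \<odot>\<^bsub>N\<^esub> h x)}"

definition radical_ideal :: "('a, 'c) ring_scheme \<Rightarrow> 'a set \<Rightarrow> bool" where
  "radical_ideal R I \<longleftrightarrow> ideal I R \<and> (\<forall>x\<in>carrier R. \<forall>k::nat. x [^]\<^bsub>R\<^esub> k \<in> I \<longrightarrow> x \<in> I)"


section \<open>The polynomial ring and its monomial ideals\<close>

text \<open>For a finite type \<open>'n\<close>, the type \<open>('n \<Rightarrow>\<^sub>0 nat) \<Rightarrow>\<^sub>0 'k\<close> is the polynomial ring over \<open>'k\<close> in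
  \<open>CARD('n)\<close> variables; \<open>'n \<Rightarrow>\<^sub>0 nat\<close> is the monoid of exponent vectors.\<close>

type_synonym ('n, 'k) mpoly = "('n \<Rightarrow>\<^sub>0 nat) \<Rightarrow>\<^sub>0 'k"

definition mpoly_ring :: "('n::finite, 'k::field) mpoly ring" where
  "mpoly_ring = ring_of_type_algebra"

definition monomial_ideal :: "('n::finite, 'k::field) mpoly set \<Rightarrow> bool" where
  "monomial_ideal I \<longleftrightarrow> (\<exists>A :: ('n \<Rightarrow>\<^sub>0 nat) set. I = Idl\<^bsub>mpoly_ring\<^esub> ((\<lambda>m. Poly_Mapping.single m 1) ` A))"

definition variables_ideal :: "('n::finite, 'k::field) mpoly set" where
  "variables_ideal = Idl\<^bsub>mpoly_ring\<^esub> range (\<lambda>i. Poly_Mapping.single (Poly_Mapping.single i 1) 1)"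

text \<open>Meant for finitely generated graded modules: \<open>depth M = dim M\<close>, where the depth is taken with
  respect to the graded maximal ideal. Elements of regular sequences need not be homogeneous.\<close>

definition cohen_macaulay :: "(('n::finite, 'k::field) mpoly, 'b) module \<Rightarrow> bool" where
  "cohen_macaulay M \<longleftrightarrow> module_grade mpoly_ring variables_ideal M = module_dim mpoly_ring M"

definition ideal_quotient_module ::
    "('n::finite, 'k::field) mpoly set \<Rightarrow> ('n, 'k) mpoly set \<Rightarrow>
     (('n, 'k) mpoly, ('n, 'k) mpoly set) module" where
  "ideal_quotient_module U I = quotient_module ((self_module mpoly_ring)\<lparr>carrier := U\<rparr>) I"


section \<open>Multigraded modules and clean filtrations\<close>

text \<open>A multigrading of \<open>M\<close> is given by its components \<open>G b \<subseteq> M\<close>, \<open>b \<in> \<int>\<^sup>n\<close>. A submodule is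
  multigraded iff each of its elements is a finite sum of homogeneous elements of the submodule.
  The notions below are meant for \<open>M\<close> that is the direct sum of the \<open>G b\<close>.\<close>

type_synonym ('n, 'b) grading = "('n \<Rightarrow> int) \<Rightarrow> 'b set"

definition mpoly_grading :: "('n::finite, ('n, 'k::field) mpoly) grading" where
  "mpoly_grading b = {p. \<forall>m\<in>Poly_Mapping.keys p. \<forall>i. int (Poly_Mapping.lookup m i) = b i}"

definition multigraded_submodule ::
    "(('n::finite, 'k::field) mpoly, 'b) module \<Rightarrow> ('n, 'b) grading \<Rightarrow> 'b set \<Rightarrow> bool" where
  "multigraded_submodule M G N \<longleftrightarrow> submodule N mpoly_ring M \<and>
     (\<forall>x\<in>N. \<exists>B h. finite B \<and> (\<forall>b\<in>B. h b \<in> N \<inter> G b) \<and> x = (\<Oplus>\<^bsub>M\<^esub>b\<in>B. h b))"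

definition restrict_grading :: "('n, 'b) grading \<Rightarrow> 'b set \<Rightarrow> ('n, 'b) grading" where
  "restrict_grading G N b = G b \<inter> N"

definition quotient_grading ::
    "('a, 'b, 'd) module_scheme \<Rightarrow> ('n, 'b) grading \<Rightarrow> 'b set \<Rightarrow> ('n, 'b set) grading" where
  "quotient_grading M G N b = (\<lambda>x. N +>\<^bsub>M\<^esub> x) ` G b"

text \<open>The grading of \<open>M(-a)\<close>, that is, \<open>M(-a)\<^sub>b = M\<^bsub>b - a\<^esub>\<close>.\<close>

definition shift_grading :: "('n \<Rightarrow> nat) \<Rightarrow> ('n, 'b) grading \<Rightarrow> ('n, 'b) grading" where
  "shift_grading a G b = G (\<lambda>i. b i - int (a i))"

definition multigraded_isomorphic ::
    "(('n::finite, 'k::field) mpoly, 'b) module \<Rightarrow> ('n, 'b) grading \<Rightarrow>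
     (('n, 'k) mpoly, 'c) module \<Rightarrow> ('n, 'c) grading \<Rightarrow> bool" where
  "multigraded_isomorphic M G N H \<longleftrightarrow>
     (\<exists>h\<in>module_iso mpoly_ring M N. \<forall>b. h ` G b = H b)"

text \<open>\<open>F i\<close> is the \<open>i\<close>-th member of the chain, and \<open>F i / F (i - 1) \<cong> S/P\<^sub>i(-a\<^sub>i)\<close> for
  \<open>1 \<le> i \<le> r\<close>, where \<open>S/P\<^sub>i\<close> carries the multigrading induced from \<open>S\<close>.\<close>

definition prime_filtration ::
    "(('n::finite, 'k::field) mpoly, 'b) module \<Rightarrow> ('n, 'b) grading \<Rightarrow> nat \<Rightarrow> (nat \<Rightarrow> 'b set) \<Rightarrow>
     (nat \<Rightarrow> ('n, 'k) mpoly set) \<Rightarrow> (nat \<Rightarrow> 'n \<Rightarrow> nat) \<Rightarrow> bool" where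
  "prime_filtration M G r F P a \<longleftrightarrow>
     F 0 = {\<zero>\<^bsub>M\<^esub>} \<and> F r = carrier M \<and>
     (\<forall>i\<le>r. multigraded_submodule M G (F i)) \<and>
     (\<forall>i\<in>{1..r}. F (i - 1) \<subset> F i \<and>
        monomial_ideal (P i) \<and> primeideal (P i) mpoly_ring \<and>
        multigraded_isomorphic
          (quotient_module (M\<lparr>carrier := F i\<rparr>) (F (i - 1)))
          (quotient_grading (M\<lparr>carrier := F i\<rparr>) (restrict_grading G (F i)) (F (i - 1)))
          (quotient_module (self_module mpoly_ring) (P i))
          (shift_grading (a i)
            (quotient_grading (self_module mpoly_ring) mpoly_grading (P i))))"

text \<open>The support of a prime filtration is the set of the primes \<open>P\<^sub>1, \<dots>, P\<^sub>r\<close>.\<close>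

definition clean ::
    "(('n::finite, 'k::field) mpoly, 'b) module \<Rightarrow> ('n, 'b) grading \<Rightarrow> bool" where
  "clean M G \<longleftrightarrow>
     (\<exists>r F P a. prime_filtration M G r F P a \<and> P ` {1..r} = min_primes mpoly_ring M)"

definition ideal_quotient_grading ::
    "('n::finite, 'k::field) mpoly set \<Rightarrow> ('n, 'k) mpoly set \<Rightarrow> ('n, ('n, 'k) mpoly set) grading" where
  "ideal_quotient_grading U I = quotient_grading ((self_module mpoly_ring)\<lparr>carrier := U\<rparr>)
     (restrict_grading mpoly_grading U) I"

end

theory Submission
  imports Defs
begin

text \<open>Let \<open>A\<close> and \<open>B\<close> be the exponent sets of \<open>I\<close> and \<open>U\<close>. Since \<open>U/I\<close> has dimension \<open>2\<close>, a monomial of \<open>U\<close>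
  outside \<open>I\<close> involves at most two variables, and depth \<open>2\<close> makes the supports of these monomials the faces
  of a graph without isolated vertices. Vanishing of local cohomology below degree \<open>2\<close> further gives:
  over an edge \<open>{i, j}\<close>, the monomials with support \<open>{i, j}\<close> form a quadrant; if \<open>c \<ge> 2\<close> is minimal with
  \<open>x\<^sub>i\<^sup>c \<in> U\<close>, then \<open>x\<^sub>i\<^bsup>c - 1\<^esup> x\<^sub>k \<notin> U\<close> for some edge \<open>{i, k}\<close>, and no power of \<open>x\<^sub>k\<close> is in \<open>U\<close>; and a
  component of the graph all of whose vertices have a power in \<open>U\<close> exists only if \<open>U = S\<close> and the graph is
  connected. Hence the edges can be ordered greedily so that the monomials over each new edge that lie over
  no earlier edge form a translate of the monomials in the two variables of that edge. Adding the edges in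
  the reverse order gives a prime filtration with one factor \<open>S/P\<^sub>e(-a\<^sub>e)\<close> for each edge \<open>e\<close>, and the primes
  \<open>P\<^sub>e\<close> are the minimal primes of \<open>U/I\<close>.\<close>

section \<open>Shelling the graph of exponents\<close>

text \<open>No local cohomology is constructed. A family \<open>w i\<close> in \<open>U\<close> with
  all \<open>x_i w_j - x_j w_i\<close> in \<open>I\<close> amounts to a homomorphism from the ideal
  of the variables to \<open>U/I\<close>; two consecutive members of a regular sequence in that
  ideal, possibly inhomogeneous, make it multiplication by some \<open>v\<close> in
  \<open>U\<close>. Every fact about the graph comes from such a family of monomials and zeros, by
  reading off one coefficient of \<open>v\<close>. The obstacle to an arbitrary order of the edges
  is that \<open>U\<close> need not be squarefree. Suppose that no placed edge contains
  \<open>i\<close>, that \<open>x_i^c\<close> is the least power of \<open>x_i\<close> in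
  \<open>U\<close> with \<open>c \<ge> 2\<close>, and that the quadrant over an edge
  \<open>{i, k}\<close> starts at an \<open>x_i\<close>-exponent below \<open>c\<close>. Then the
  new monomials over this edge have both the corner of the quadrant and \<open>x_i^c\<close> as
  minimal elements, and they are no translate. The next edge at such an \<open>i\<close> must
  therefore be one whose quadrant starts at exponent \<open>c\<close>; a neighbour \<open>k\<close>
  with \<open>x_i^(c-1) x_k\<close> outside \<open>U\<close> provides it.\<close>

definition var :: "'n \<Rightarrow> ('n \<Rightarrow>\<^sub>0 nat)" where
  "var k = Poly_Mapping.single k 1"

lemma lookup_var: "Poly_Mapping.lookup (var k) i = (if i = k then 1 else 0)"
  by (simp add: var_def lookup_single when_def)

lemma keys_var [simp]: "Poly_Mapping.keys (var k) = {k}"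
  by (simp add: var_def)

lemma keys_add_nat: "Poly_Mapping.keys (a + b) = Poly_Mapping.keys a \<union> Poly_Mapping.keys (b :: 'n \<Rightarrow>\<^sub>0 nat)"
  by (auto simp: in_keys_iff lookup_add)

lemma keys_diff_nat: "Poly_Mapping.keys (m - a) \<subseteq> Poly_Mapping.keys (m :: 'n \<Rightarrow>\<^sub>0 nat)"
proof
  fix x assume "x \<in> Poly_Mapping.keys (m - a)"
  then have "Poly_Mapping.lookup m x - Poly_Mapping.lookup a x \<noteq> 0" by (simp add: in_keys_iff lookup_minus)
  then have "Poly_Mapping.lookup m x \<noteq> 0" by linarith
  then show "x \<in> Poly_Mapping.keys m" by (simp add: in_keys_iff)
qed

lemma exponent_eq_add_diff:
  fixes a m :: "'n \<Rightarrow>\<^sub>0 nat"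
  assumes "\<And>i. Poly_Mapping.lookup a i \<le> Poly_Mapping.lookup m i"
  shows "m = a + (m - a)"
  by (rule poly_mapping_eqI) (use assms in \<open>simp add: lookup_add lookup_minus\<close>)

text \<open>Up to multigraded degree, \<open>lift\<close> is the vanishing of the first local cohomology in nonnegative degrees,
  while \<open>extend\<close> combines the vanishing of the zeroth one with that of the first one in negative degrees.\<close>

locale depth_two_exponents =
  fixes A B :: "('n::finite \<Rightarrow>\<^sub>0 nat) set"
  assumes A_subset: "A \<subseteq> B"
    and A_keys: "\<lbrakk>m \<in> A; Poly_Mapping.keys m \<subseteq> Poly_Mapping.keys m'\<rbrakk> \<Longrightarrow> m' \<in> A"
    and B_up: "m \<in> B \<Longrightarrow> m + t \<in> B"
    and dim_le_two: "\<lbrakk>m \<in> B; 3 \<le> card (Poly_Mapping.keys m)\<rbrakk> \<Longrightarrow> m \<in> A"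
    and lift: "\<lbrakk>\<And>k. k \<in> T \<Longrightarrow> m + var k \<in> B;
        \<And>k l. \<lbrakk>k \<in> T; l \<notin> T\<rbrakk> \<Longrightarrow> m + var k + var l \<in> A; k \<in> T; m + var k \<notin> A\<rbrakk>
      \<Longrightarrow> m \<in> B \<and> (\<forall>l. l \<notin> T \<longrightarrow> m + var l \<in> A)"
    and extend: "m \<in> B - A \<Longrightarrow> \<exists>k. k \<noteq> i \<and> m + var k \<notin> A"
begin

section \<open>The graph formed by the supports of size two\<close>

definition edges :: "'n set set" where
  "edges = {e. card e = 2 \<and> (\<exists>m\<in>B - A. Poly_Mapping.keys m = e)}"

text \<open>\<open>A\<close> is closed under enlarging the support, so otherwise the monomial
  outside \<open>A\<close> that witnesses the edge would lie in \<open>A\<close>.\<close>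

lemma notin_A_if_keys_subset_edge: "\<lbrakk>e \<in> edges; Poly_Mapping.keys m \<subseteq> e\<rbrakk> \<Longrightarrow> m \<notin> A"
  using A_keys unfolding edges_def by blast

text \<open>Dimension bounds the support by two variables, and \<open>extend\<close> enlarges a
  smaller one. From support \<open>{i}\<close> it is the choice \<open>k \<noteq> i\<close> that
  makes the support grow; from the empty support one multiplication leads to the singleton
  case.\<close>

lemma keys_subset_edge:
  assumes "m \<in> B - A"
  shows "\<exists>e\<in>edges. Poly_Mapping.keys m \<subseteq> e"
proof -
  have one: "\<exists>e\<in>edges. Poly_Mapping.keys m \<subseteq> e" if m: "m \<in> B - A" "Poly_Mapping.keys m = {i}" for m i
  proof -
    obtain k where k: "k \<noteq> i" "m + var k \<notin> A" using extend[OF m(1)] by blast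
    have "m + var k \<in> B - A" "card (Poly_Mapping.keys (m + var k)) = 2"
      using k m B_up by (auto simp: keys_add_nat)
    then have "Poly_Mapping.keys (m + var k) \<in> edges" by (auto simp: edges_def)
    then show ?thesis by (auto simp: keys_add_nat)
  qed
  consider "card (Poly_Mapping.keys m) = 2" | "card (Poly_Mapping.keys m) = 1" | "card (Poly_Mapping.keys m) = 0"
    using dim_le_two[of m] assms by fastforce
  then show ?thesis
  proof cases
    case 1
    then have "Poly_Mapping.keys m \<in> edges" using assms by (auto simp: edges_def)
    then show ?thesis by blast
  next
    case 2
    then obtain i where "Poly_Mapping.keys m = {i}" by (auto simp: card_1_singleton_iff)
    then show ?thesis using one assms by blast
  next
    case 3
    then have k: "Poly_Mapping.keys m = {}" by simp
    obtain k where "m + var k \<notin> A" using extend[OF assms] by blast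
    moreover have "m + var k \<in> B" using assms B_up by auto
    ultimately have "\<exists>e\<in>edges. Poly_Mapping.keys (m + var k) \<subseteq> e"
      using one[of "m + var k" k] by (simp add: keys_add_nat k)
    then show ?thesis using k by auto
  qed
qed

lemma edgeE:
  assumes "e \<in> edges"
  obtains i j where "i \<noteq> j" "e = {i, j}"
  using assms by (auto simp: edges_def card_2_iff)

lemma edgeI:
  assumes "m \<in> B" "m \<notin> A" "Poly_Mapping.keys m = {i, j}" "i \<noteq> j"
  shows "{i, j} \<in> edges"
  using assms by (auto simp: edges_def intro!: bexI[of _ m])

section \<open>Monomials over a single edge\<close>

lemma triple_in_A:
  assumes "m \<in> B" "{i, j, l} \<subseteq> Poly_Mapping.keys m" "i \<noteq> j" "l \<noteq> i" "l \<noteq> j"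
  shows "m \<in> A"
proof (rule dim_le_two[OF assms(1)])
  have "card {i, j, l} = 3" using assms by simp
  then show "3 \<le> card (Poly_Mapping.keys m)"
    using card_mono[OF finite_keys assms(2)] by simp
qed

text \<open>This is \<open>lift\<close> with \<open>T = {i, j}\<close>: a further variable
  multiplied to \<open>m + var i\<close> or \<open>m + var j\<close> produces three variables, so
  the required memberships in \<open>A\<close> hold by dimension.\<close>

lemma diamond:
  assumes e: "{i, j} \<in> edges" "i \<noteq> j" and k: "Poly_Mapping.keys m = {i, j}"
    and m: "m + var i \<in> B" "m + var j \<in> B"
  shows "m \<in> B"
proof -
  have "m \<in> B \<and> (\<forall>l. l \<notin> {i,j} \<longrightarrow> m + var l \<in> A)"
  proof (rule lift[of "{i,j}" m i])
    fix k assume "k \<in> {i,j}" then show "m + var k \<in> B" using m by auto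
  next
    fix p l assume p: "p \<in> {i,j}" and l: "l \<notin> {i,j}"
    show "m + var p + var l \<in> A"
    proof (rule triple_in_A[of _ i j l])
      show "m + var p + var l \<in> B" using m p B_up by auto
    qed (use e k l in \<open>auto simp: keys_add_nat\<close>)
  next
    show "m + var i \<notin> A" by (rule notin_A_if_keys_subset_edge[OF e(1)]) (auto simp: k keys_add_nat)
  qed auto
  then show ?thesis by simp
qed

text \<open>Iterates \<open>diamond\<close> over a grid; the points needed above and to the right
  are supplied by \<open>B_up\<close>.\<close>

lemma rectangle:
  assumes e: "{i, j} \<in> edges" "i \<noteq> j" and k: "Poly_Mapping.keys m = {i, j}"
    and m: "m + Poly_Mapping.single i p \<in> B" "m + Poly_Mapping.single j q \<in> B"
  shows "m \<in> B"
proof -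
  have S: "x + Poly_Mapping.single i (Suc n) = x + var i + Poly_Mapping.single i n" for x n and i :: 'n
    by (simp add: var_def add.assoc single_add[symmetric])
  \<comment> \<open>One column of the grid: descent in the power of \<open>x_j\<close> while the
    neighbour in direction \<open>i\<close> stays available.\<close>
  have strip: "m \<in> B" if "Poly_Mapping.keys m = {i, j}" "m + var i \<in> B" "m + Poly_Mapping.single j q \<in> B" for m q
    using that
  proof (induction q arbitrary: m)
    case (Suc q)
    have "m + var j \<in> B"
    proof (rule Suc.IH)
      have "m + var j + var i = m + var i + var j" by (simp add: ac_simps)
      then show "m + var j + var i \<in> B" using Suc.prems B_up by metis
    qed (use Suc.prems S in \<open>auto simp: keys_add_nat\<close>)
    then show ?case using diamond[OF e] Suc.prems by blast
  qed simp
  show ?thesis using k m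
  proof (induction p arbitrary: m)
    case (Suc p)
    have "m + var i \<in> B"
    proof (rule Suc.IH)
      have "m + var i + Poly_Mapping.single j q = m + Poly_Mapping.single j q + var i" by (simp add: ac_simps)
      then show "m + var i + Poly_Mapping.single j q \<in> B" using Suc.prems B_up by metis
    qed (use Suc.prems S in \<open>auto simp: keys_add_nat\<close>)
    then show ?case using strip Suc.prems by blast
  qed simp
qed

text \<open>An upward closed set of exponents over an edge is a union of quadrants;
  \<open>rectangle\<close>, applied to the componentwise minimum, shows that there is only one
  corner.\<close>

lemma quadrant:
  assumes e: "e \<in> edges"
  shows "\<exists>a. {m \<in> B. Poly_Mapping.keys m = e} = {a + t |t. Poly_Mapping.keys t \<subseteq> e}"
proof -
  obtain i j where ij: "i \<noteq> j" "e = {i, j}" using edgeE[OF e] .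
  define Q where "Q = {m \<in> B. Poly_Mapping.keys m = e}"
  have Q: "Q \<noteq> {}" using e unfolding edges_def Q_def by blast
  obtain m where m: "m \<in> Q" "\<And>m'. m' \<in> Q \<Longrightarrow> Poly_Mapping.lookup m i \<le> Poly_Mapping.lookup m' i"
    using Q ex_has_least_nat[of "\<lambda>x. x \<in> Q" _ "\<lambda>x. Poly_Mapping.lookup x i"] by blast
  obtain n where n: "n \<in> Q" "\<And>m'. m' \<in> Q \<Longrightarrow> Poly_Mapping.lookup n j \<le> Poly_Mapping.lookup m' j"
    using Q ex_has_least_nat[of "\<lambda>x. x \<in> Q" _ "\<lambda>x. Poly_Mapping.lookup x j"] by blast
  \<comment> \<open>The corner takes its \<open>i\<close>-coordinate from \<open>m\<close> and its
    \<open>j\<close>-coordinate from \<open>n\<close>. Each of the two differs from it in one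
    direction only, as \<open>rectangle\<close> requires.\<close>
  define a where "a = Poly_Mapping.single i (Poly_Mapping.lookup m i) + Poly_Mapping.single j (Poly_Mapping.lookup n j)"
  have la: "Poly_Mapping.lookup a k = (if k = i then Poly_Mapping.lookup m i else if k = j then Poly_Mapping.lookup n j else 0)" for k
    using ij by (auto simp: a_def lookup_add lookup_single when_def)
  have nz: "Poly_Mapping.lookup m i \<noteq> 0" "Poly_Mapping.lookup n j \<noteq> 0"
    unfolding in_keys_iff[symmetric] using m(1) n(1) ij by (auto simp: Q_def)
  have ka: "Poly_Mapping.keys a = {i,j}"
    using nz by (auto simp: in_keys_iff la split: if_splits)
  have zero: "Poly_Mapping.lookup m' k = 0" if "m' \<in> Q" "k \<noteq> i" "k \<noteq> j" for m' k
  proof -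
    have "k \<notin> Poly_Mapping.keys m'" using that ij by (simp add: Q_def)
    then show ?thesis by (simp add: in_keys_iff)
  qed
  have m_eq: "m = a + Poly_Mapping.single j (Poly_Mapping.lookup m j - Poly_Mapping.lookup n j)"
    using n(2)[OF m(1)] ij zero[OF m(1)] by (intro poly_mapping_eqI) (auto simp: lookup_add la lookup_single when_def)
  have n_eq: "n = a + Poly_Mapping.single i (Poly_Mapping.lookup n i - Poly_Mapping.lookup m i)"
    using m(2)[OF n(1)] ij zero[OF n(1)] by (intro poly_mapping_eqI) (auto simp: lookup_add la lookup_single when_def)
  have "m \<in> B" "n \<in> B" using m n by (auto simp: Q_def)
  then have a: "a \<in> B" using rectangle[of i j a] e ij ka m_eq n_eq by metis
  have "Q = {a + t |t. Poly_Mapping.keys t \<subseteq> e}"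
  proof (intro equalityI subsetI)
    fix x assume x: "x \<in> Q"
    have "x = a + (x - a)"
      by (rule exponent_eq_add_diff) (use m(2)[OF x] n(2)[OF x] in \<open>auto simp: la\<close>)
    moreover have "Poly_Mapping.keys (x - a) \<subseteq> e"
      using x keys_diff_nat[of x a] by (simp add: Q_def)
    ultimately show "x \<in> {a + t |t. Poly_Mapping.keys t \<subseteq> e}" by blast
  next
    fix x assume "x \<in> {a + t |t. Poly_Mapping.keys t \<subseteq> e}"
    then show "x \<in> Q" using a B_up ka ij by (auto simp: Q_def keys_add_nat)
  qed
  then show ?thesis unfolding Q_def by blast
qed

text \<open>Otherwise \<open>lift\<close>, applied to \<open>x_i^(c-1)\<close> and the closed
  neighbourhood \<open>T\<close> of \<open>i\<close>, would put \<open>x_i^(c-1)\<close> into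
  \<open>U\<close>. As \<open>c \<ge> 2\<close>, this monomial involves \<open>x_i\<close>, so a
  neighbour and a non-neighbour together give three variables, while \<open>i\<close> and a
  non-neighbour give a non-edge.\<close>

lemma minimal_power_neighbour:
  assumes i: "i \<in> \<Union>edges" and c: "Poly_Mapping.single i c \<in> B" "c \<ge> 2"
    and least: "Poly_Mapping.single i (c - 1) \<notin> B"
  shows "\<exists>k. {i, k} \<in> edges \<and> k \<noteq> i \<and> Poly_Mapping.single i (c - 1) + var k \<notin> B"
proof (rule ccontr)
  assume neg: "\<not> ?thesis"
  define m where "m = Poly_Mapping.single i (c - 1)"
  define T where "T = {k. k = i \<or> {i, k} \<in> edges}"
  have km: "Poly_Mapping.keys m = {i}" using c by (simp add: m_def)
  have mi: "m + var i \<in> B" using c by (simp add: m_def var_def single_add[symmetric])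
  have "m \<in> B \<and> (\<forall>l. l \<notin> T \<longrightarrow> m + var l \<in> A)"
  proof (rule lift[of T m i])
    fix k assume "k \<in> T"
    then show "m + var k \<in> B" using neg mi by (cases "k = i") (auto simp: T_def m_def)
  next
    fix k l assume k: "k \<in> T" and l: "l \<notin> T"
    have B: "m + var k + var l \<in> B"
      using neg mi k B_up by (cases "k = i") (auto simp: T_def m_def)
    show "m + var k + var l \<in> A"
    proof (cases "k = i")
      case True
      show ?thesis
      proof (rule ccontr)
        assume "m + var k + var l \<notin> A"
        then have "{i, l} \<in> edges" using B l True by (intro edgeI) (auto simp: keys_add_nat km T_def)
        then show False using l by (auto simp: T_def)
      qed
    next
      case False
      show ?thesis using B False k l
        by (intro triple_in_A[of _ i k l]) (auto simp: keys_add_nat km T_def)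
    qed
  next
    obtain e where "e \<in> edges" "i \<in> e" using i by blast
    then show "m + var i \<notin> A" by (intro notin_A_if_keys_subset_edge) (auto simp: keys_add_nat km)
  qed (auto simp: T_def)
  then show False using least by (simp add: m_def)
qed

section \<open>Placing the edges one at a time\<close>

text \<open>The part of \<open>B\<close> still to be filtered once the edges in \<open>E\<close> have been placed at the top.\<close>

definition residual :: "'n set set \<Rightarrow> ('n \<Rightarrow>\<^sub>0 nat) set" where
  "residual E = A \<union> {m \<in> B. \<forall>e\<in>E. \<not> Poly_Mapping.keys m \<subseteq> e}"

lemma residual_diff_insert:
  assumes "e \<in> edges"
  shows "residual E - residual (insert e E) = {m \<in> B. Poly_Mapping.keys m \<subseteq> e \<and> (\<forall>e'\<in>E. \<not> Poly_Mapping.keys m \<subseteq> e')}"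
  using notin_A_if_keys_subset_edge[OF assms] by (auto simp: residual_def)

text \<open>The cases are whether some unplaced edge has two, some has one, or none has any
  \<open>ok\<close> endpoint. Two leave exactly the quadrant of full support; one leaves also the
  powers of the other vertex; none is possible only at the very start, with
  \<open>U = S\<close>.\<close>

lemma shelling_step:
  assumes E: "E \<subset> edges"
  shows "\<exists>e\<in>edges - E. \<exists>a. residual E - residual (insert e E) = {a + t |t. Poly_Mapping.keys t \<subseteq> e}"
proof -
  \<comment> \<open>At an \<open>ok\<close> vertex no monomial supported on \<open>{i}\<close> can
    be new. The exponent \<open>c = 0\<close> is included on purpose: if \<open>1\<close> lies in
    \<open>U\<close>, only a placed edge through \<open>i\<close> makes \<open>i\<close> ok.\<close>
  define ok where "ok i \<longleftrightarrow> i \<in> \<Union>E \<or> (\<forall>c. Poly_Mapping.single i c \<notin> B)" for i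
  have cov: "\<exists>e\<in>E. Poly_Mapping.keys m \<subseteq> e" if "ok i" "m \<in> B" "Poly_Mapping.keys m \<subseteq> {i}" for i m
  proof -
    have "m = Poly_Mapping.single i (Poly_Mapping.lookup m i)"
      using that(3) by (intro poly_mapping_eqI) (auto simp: lookup_single when_def in_keys_iff)
    then have "i \<in> \<Union>E" using that by (metis ok_def)
    then show ?thesis using that(3) by blast
  qed
  have E': "\<And>e i. \<lbrakk>e \<in> E; i \<in> e\<rbrakk> \<Longrightarrow> ok i" by (auto simp: ok_def)
  show ?thesis
  proof (cases "\<exists>e\<in>edges - E. \<forall>i\<in>e. ok i")
    case True
    then obtain e where e: "e \<in> edges" "e \<notin> E" "\<And>i. i \<in> e \<Longrightarrow> ok i" by blast
    obtain i j where ij: "i \<noteq> j" "e = {i, j}" using edgeE[OF e(1)] .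
    have "residual E - residual (insert e E) = {m \<in> B. Poly_Mapping.keys m = e}"
      unfolding residual_diff_insert[OF e(1)]
    proof (intro Collect_cong conj_cong refl iffI conjI ballI)
      fix m assume m: "m \<in> B" "Poly_Mapping.keys m \<subseteq> e \<and> (\<forall>e'\<in>E. \<not> Poly_Mapping.keys m \<subseteq> e')"
      then have "\<not> Poly_Mapping.keys m \<subseteq> {i}" "\<not> Poly_Mapping.keys m \<subseteq> {j}"
        using cov[of i m] cov[of j m] e(3) ij by blast+
      then show "Poly_Mapping.keys m = e" using m ij by auto
    next
      fix m :: "'n \<Rightarrow>\<^sub>0 nat" and e' assume m: "Poly_Mapping.keys m = e" "e' \<in> E"
      have "card e' = 2" "card e = 2" "finite e'" using E e(1) m(2) by (auto simp: edges_def)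
      then show "\<not> Poly_Mapping.keys m \<subseteq> e'" using e(2) m card_subset_eq[of e' e] by auto
    qed auto
    then show ?thesis using quadrant[OF e(1)] e(1,2) by (metis (no_types, lifting) DiffI)
  next
    case allbad: False
    show ?thesis
    proof (cases "\<exists>e\<in>edges - E. \<exists>j\<in>e. ok j")
      case True
      then obtain e j where e: "e \<in> edges" "e \<notin> E" "j \<in> e" "ok j" by blast
      then obtain i where i: "i \<in> e" "\<not> ok i" using allbad by blast
      then have ij: "i \<noteq> j" "e = {i, j}" using e edgeE[OF e(1)] by auto
      define c where "c = (LEAST c. Poly_Mapping.single i c \<in> B)"
      have c: "Poly_Mapping.single i c \<in> B" "\<And>c'. Poly_Mapping.single i c' \<in> B \<Longrightarrow> c \<le> c'"
        using i(2) unfolding c_def ok_def by (metis LeastI, metis Least_le)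
      \<comment> \<open>If \<open>x\<^sub>i\<^sup>c\<close> with \<open>c \<ge> 1\<close> generates everything new along an edge \<open>{i, k}\<close> with \<open>k\<close> ok, that edge may come next.\<close>
      have step: ?thesis if k: "{i, k} \<in> edges" "i \<noteq> k" "ok k" and c': "Poly_Mapping.single i c' \<in> B" "c' \<ge> 1"
        and le: "\<And>m. \<lbrakk>m \<in> B; Poly_Mapping.keys m \<subseteq> {i, k}; i \<in> Poly_Mapping.keys m\<rbrakk> \<Longrightarrow> c' \<le> Poly_Mapping.lookup m i" for k c'
      proof -
        have "residual E - residual (insert {i, k} E) = {Poly_Mapping.single i c' + t |t. Poly_Mapping.keys t \<subseteq> {i, k}}"
          unfolding residual_diff_insert[OF k(1)]
        proof (intro equalityI subsetI)
          fix m assume "m \<in> {m \<in> B. Poly_Mapping.keys m \<subseteq> {i, k} \<and> (\<forall>e'\<in>E. \<not> Poly_Mapping.keys m \<subseteq> e')}"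
          then have m: "m \<in> B" "Poly_Mapping.keys m \<subseteq> {i, k}" "\<forall>e'\<in>E. \<not> Poly_Mapping.keys m \<subseteq> e'" by auto
          have "\<not> Poly_Mapping.keys m \<subseteq> {k}" using cov[OF k(3) m(1)] m(3) by blast
          then have "i \<in> Poly_Mapping.keys m" using m(2) by auto
          then have "c' \<le> Poly_Mapping.lookup m i" using le m by blast
          then have "m = Poly_Mapping.single i c' + (m - Poly_Mapping.single i c')"
            by (intro exponent_eq_add_diff) (auto simp: lookup_single when_def)
          moreover have "Poly_Mapping.keys (m - Poly_Mapping.single i c') \<subseteq> {i, k}"
            by (rule subset_trans[OF keys_diff_nat m(2)])
          ultimately show "m \<in> {Poly_Mapping.single i c' + t |t. Poly_Mapping.keys t \<subseteq> {i, k}}" by blast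
        next
          fix m assume "m \<in> {Poly_Mapping.single i c' + t |t. Poly_Mapping.keys t \<subseteq> {i, k}}"
          then obtain t where t: "m = Poly_Mapping.single i c' + t" "Poly_Mapping.keys t \<subseteq> {i, k}" by blast
          have "i \<in> Poly_Mapping.keys m" "Poly_Mapping.keys m \<subseteq> {i,k}" using t c' by (auto simp: keys_add_nat)
          then show "m \<in> {m \<in> B. Poly_Mapping.keys m \<subseteq> {i, k} \<and> (\<forall>e'\<in>E. \<not> Poly_Mapping.keys m \<subseteq> e')}"
            using t c' B_up i(2) E' by auto
        qed
        moreover have "{i, k} \<notin> E" using i(2) E' by blast
        ultimately show ?thesis using k(1) by blast
      qed
      show ?thesis
      proof (cases "c \<ge> 2")
        case False
        \<comment> \<open>The least exponent \<open>c = 0\<close> is treated as \<open>1\<close>: if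
          \<open>1\<close> lies in \<open>U\<close>, then \<open>j\<close> can be ok only through a
          placed edge, which already covers \<open>1\<close>.\<close>
        have "Poly_Mapping.single i 1 \<in> B"
        proof (cases "c = 0")
          case True
          then show ?thesis using c(1) B_up[of 0 "Poly_Mapping.single i 1"] by simp
        next
          case c0: False
          then have "c = 1" using False by simp
          then show ?thesis using c(1) by simp
        qed
        then show ?thesis using step[of j 1] e ij
          by (auto simp: in_keys_iff Suc_le_eq)
      next
        case True
        have l: "Poly_Mapping.single i (c - 1) \<notin> B" using c(2)[of "c - 1"] True by auto
        \<comment> \<open>The given edge \<open>{i, j}\<close> may have a quadrant starting below
          \<open>c\<close>; it is exchanged for an edge \<open>{i, k}\<close> that cannot.\<close>
        obtain k where k: "{i, k} \<in> edges" "k \<noteq> i" "Poly_Mapping.single i (c - 1) + var k \<notin> B"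
          using minimal_power_neighbour[OF _ c(1) True l] e(1) i(1) by blast
        have top: "Poly_Mapping.single i (c - 1) + var k + Poly_Mapping.single i 1 \<in> B"
        proof -
          have "Poly_Mapping.single i c = Poly_Mapping.single i (c - 1) + Poly_Mapping.single i 1"
            using True by (simp add: single_add[symmetric])
          then have "Poly_Mapping.single i (c - 1) + var k + Poly_Mapping.single i 1 = Poly_Mapping.single i c + var k"
            by (simp add: ac_simps)
          then show ?thesis using B_up[OF c(1)] by simp
        qed
        have kk: "Poly_Mapping.keys (Poly_Mapping.single i (c - 1) + var k) = {i, k}"
          using True by (simp add: keys_add_nat insert_commute)
        \<comment> \<open>Since \<open>x_i^c x_k\<close> is in \<open>U\<close>, a single member of
          this column would force its bottom \<open>x_i^(c-1) x_k\<close> into \<open>U\<close>. The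
          empty column yields both \<open>ok k\<close> and the bound \<open>c\<close> on the
          exponent of \<open>x_i\<close>.\<close>
        have rect: "Poly_Mapping.single i (c - 1) + var k + Poly_Mapping.single k q \<notin> B" for q
          using rectangle[OF k(1) k(2)[symmetric] kk top] k(3) by blast
        have "ok k"
          unfolding ok_def
        proof (intro disjI2 allI notI)
          fix b assume b: "Poly_Mapping.single k b \<in> B"
          have "Poly_Mapping.single i (c - 1) + var k + Poly_Mapping.single k b \<in> B"
            using B_up[OF b, of "Poly_Mapping.single i (c - 1) + var k"] by (simp add: ac_simps)
          then show False using rect by blast
        qed
        moreover have "c \<le> Poly_Mapping.lookup m i" if m: "m \<in> B" "Poly_Mapping.keys m \<subseteq> {i, k}" for m
        proof (rule ccontr)
          assume "\<not> c \<le> Poly_Mapping.lookup m i"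
          \<comment> \<open>Raising the exponent of \<open>x_i\<close> to \<open>c - 1\<close> and
            adding one factor \<open>x_k\<close> moves \<open>m\<close> into the empty
            column.\<close>
          then have "Poly_Mapping.single i (c - 1) + var k + Poly_Mapping.single k (Poly_Mapping.lookup m k)
             = m + (Poly_Mapping.single i (c - 1 - Poly_Mapping.lookup m i) + var k)"
            using m(2) k(2)
            by (intro poly_mapping_eqI) (auto simp: lookup_add lookup_single lookup_var when_def in_keys_iff)
          then show False using rect B_up[OF m(1)] by metis
        qed
        ultimately show ?thesis using step[of k c] k c(1) True by auto
      qed
    next
      case False
      then have new: "\<not> ok i" if "e \<in> edges" "e \<notin> E" "i \<in> e" for e i using that by blast
      obtain e where e: "e \<in> edges" "e \<notin> E" using E by blast
      obtain i0 j0 where ij0: "i0 \<noteq> j0" "e = {i0, j0}" using edgeE[OF e(1)] .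
      \<comment> \<open>An edge through a vertex that is not ok is unplaced, so neither of its ends
        is ok. Hence \<open>T\<close> is a union of components of the graph that meets no placed
        edge.\<close>
      define T where "T = {i \<in> \<Union>edges. \<not> ok i}"
      \<comment> \<open>If \<open>x_i\<close> were missing, the least exponent would be at least
        two. The neighbour from \<open>minimal_power_neighbour\<close> is again not ok, so it has a
        power in \<open>U\<close>, and the powers of both vertices span a rectangle with the
        forbidden corner.\<close>
      have T_var: "var i \<in> B" if i: "i \<in> T" for i
      proof (rule ccontr)
        assume nB: "var i \<notin> B"
        define c where "c = (LEAST c. Poly_Mapping.single i c \<in> B)"
        have c: "Poly_Mapping.single i c \<in> B" "\<And>c'. Poly_Mapping.single i c' \<in> B \<Longrightarrow> c \<le> c'"
          using i unfolding c_def ok_def T_def by (auto intro: LeastI Least_le)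
        have "c \<noteq> 1" using nB c(1) by (auto simp: var_def)
        moreover have "c \<noteq> 0"
        proof
          assume "c = 0"
          then show False using nB c(1) B_up[of 0 "var i"] by simp
        qed
        ultimately have c2: "c \<ge> 2" by simp
        have "Poly_Mapping.single i (c - 1) \<notin> B" using c(2)[of "c - 1"] c2 by auto
        then obtain k where k: "{i, k} \<in> edges" "k \<noteq> i" "Poly_Mapping.single i (c - 1) + var k \<notin> B"
          using minimal_power_neighbour[OF _ c(1) c2] i unfolding T_def by blast
        have "\<not> ok i" using i by (simp add: T_def)
        then have "{i, k} \<notin> E" using E' by blast
        then have "\<not> ok k" using new k(1) by blast
        then obtain b where b: "Poly_Mapping.single k b \<in> B" by (auto simp: ok_def)
        have "Poly_Mapping.single i c = Poly_Mapping.single i (c - 1) + Poly_Mapping.single i 1"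
          using c2 by (simp add: single_add[symmetric])
        then have "Poly_Mapping.single i (c - 1) + var k + Poly_Mapping.single i 1 = Poly_Mapping.single i c + var k"
          by (simp add: ac_simps)
        then have top: "Poly_Mapping.single i (c - 1) + var k + Poly_Mapping.single i 1 \<in> B"
          using B_up[OF c(1)] by simp
        have side: "Poly_Mapping.single i (c - 1) + var k + Poly_Mapping.single k b \<in> B"
          using B_up[OF b, of "Poly_Mapping.single i (c - 1) + var k"] by (simp add: ac_simps)
        have kk: "Poly_Mapping.keys (Poly_Mapping.single i (c - 1) + var k) = {i, k}"
          using c2 by (simp add: keys_add_nat insert_commute)
        have "Poly_Mapping.single i (c - 1) + var k \<in> B"
          by (rule rectangle[OF k(1) k(2)[symmetric] kk top side])
        then show False using k(3) by simp
      qed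
      have i0: "i0 \<in> T" using e ij0 new by (auto simp: T_def)
      \<comment> \<open>Here \<open>lift\<close> is applied to the monomial \<open>1\<close>: the
        variables indexed by \<open>T\<close> lie in \<open>U\<close>, and no edge joins
        \<open>T\<close> to its complement. Besides \<open>1 \<in> U\<close> it gives that every
        variable outside \<open>T\<close> is in \<open>I\<close>.\<close>
      have "0 \<in> B \<and> (\<forall>l. l \<notin> T \<longrightarrow> 0 + var l \<in> A)"
      proof (rule lift[of T 0 i0])
        fix k l assume k: "k \<in> T" and l: "l \<notin> T"
        show "0 + var k + var l \<in> A"
        proof (rule ccontr)
          assume "0 + var k + var l \<notin> A"
          then have kl: "{k, l} \<in> edges"
            using T_var[OF k] B_up k l by (intro edgeI[of "0 + var k + var l"]) (auto simp: keys_add_nat)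
          have "{k, l} \<notin> E" using k E' unfolding T_def by blast
          then have "\<not> ok l" using new kl by blast
          then show False using l kl by (auto simp: T_def)
        qed
      next
        show "0 + var i0 \<notin> A" by (rule notin_A_if_keys_subset_edge[OF e(1)]) (use ij0 in auto)
      qed (use T_var i0 in auto)
      then have zero: "0 \<in> B" "\<And>l. l \<notin> T \<Longrightarrow> var l \<in> A" by auto
      \<comment> \<open>The vertices of a placed edge lie outside \<open>T\<close>, so their
        variables would be in \<open>I\<close>, which is impossible for vertices of an edge. With
        nothing placed and \<open>U = S\<close>, any edge starts the order, with translation
        \<open>0\<close>.\<close>
      have "E = {}"
      proof (rule ccontr)
        assume "E \<noteq> {}"
        then obtain e' where e': "e' \<in> E" "e' \<in> edges" using E by blast
        then obtain l where l: "l \<in> e'" using edgeE by blast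
        then have "var l \<notin> A" using notin_A_if_keys_subset_edge[OF e'(2)] by simp
        moreover have "l \<notin> T" using E' e' l by (auto simp: T_def)
        ultimately show False using zero by blast
      qed
      then have "residual E - residual (insert e E) = {0 + t |t. Poly_Mapping.keys t \<subseteq> e}"
        unfolding residual_diff_insert[OF e(1)] using B_up[OF zero(1)] by auto
      then show ?thesis using e by blast
    qed
  qed
qed

lemma residual_up: "m \<in> residual E \<Longrightarrow> m + t \<in> residual E"
  using A_keys[of m "m + t"] B_up by (auto simp: residual_def keys_add_nat)

text \<open>The edge chosen next becomes the top factor. Induction on the number of unplaced edges
  therefore supplies the chain below it, starting from \<open>residual edges = A\<close>.\<close>

lemma residual_chain:
  assumes "E \<subseteq> edges"
  shows "\<exists>(r::nat) C e a. C 0 = A \<and> C r = residual E \<and> e ` {1..r} = edges - E \<and>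
    (\<forall>i\<le>r. \<forall>m\<in>C i. \<forall>t. m + t \<in> C i) \<and>
    (\<forall>i\<in>{1..r}. C (i - 1) \<subseteq> C i \<and> C i - C (i - 1) = {a i + t |t. Poly_Mapping.keys t \<subseteq> e i})"
  using assms
proof (induction "card (edges - E)" arbitrary: E rule: less_induct)
  case less
  show ?case
  proof (cases "E = edges")
    case True
    have "residual E = A" using A_subset keys_subset_edge by (auto simp: True residual_def)
    moreover have "m + t \<in> A" if "m \<in> A" for m t using A_keys[OF that] by (auto simp: keys_add_nat)
    ultimately show ?thesis using True
      by - (rule exI[of _ "0::nat"], rule exI[of _ "\<lambda>_. A"], rule exI[of _ "\<lambda>_. {}"], rule exI[of _ "\<lambda>_. 0"], auto)
  next
    case False
    then have "E \<subset> edges" using less.prems by auto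
    from shelling_step[OF this] obtain e0 a0 where e0: "e0 \<in> edges - E"
      and d: "residual E - residual (insert e0 E) = {a0 + t |t. Poly_Mapping.keys t \<subseteq> e0}"
      by (elim bexE exE)
    have "card (edges - insert e0 E) < card (edges - E)"
      by (rule psubset_card_mono) (use e0 in auto)
    moreover have "insert e0 E \<subseteq> edges" using e0 less.prems by auto
    ultimately have "\<exists>(r::nat) C e a. C 0 = A \<and> C r = residual (insert e0 E) \<and> e ` {1..r} = edges - insert e0 E \<and>
      (\<forall>i\<le>r. \<forall>m\<in>C i. \<forall>t. m + t \<in> C i) \<and>
      (\<forall>i\<in>{1..r}. C (i - 1) \<subseteq> C i \<and> C i - C (i - 1) = {a i + t |t. Poly_Mapping.keys t \<subseteq> e i})"
      by (rule less.hyps)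
    then obtain r :: nat and C e a where C: "C 0 = A" "C r = residual (insert e0 E)" "e ` {1..r} = edges - insert e0 E"
      "\<forall>i\<le>r. \<forall>m\<in>C i. \<forall>t. m + t \<in> C i"
      "\<forall>i\<in>{1..r}. C (i - 1) \<subseteq> C i \<and> C i - C (i - 1) = {a i + t |t. Poly_Mapping.keys t \<subseteq> e i}"
      by (elim exE conjE)
    have up: "\<forall>m\<in>residual E. \<forall>t. m + t \<in> residual E" by (intro ballI allI residual_up)
    have sub: "residual (insert e0 E) \<subseteq> residual E" by (auto simp: residual_def)
    have I: "{1..Suc r} = insert (Suc r) {1..r}" by auto
    have im: "e(Suc r := e0) ` {1..r} = e ` {1..r}" by (rule image_cong) auto
    have "insert e0 (edges - insert e0 E) = edges - E" using e0 by blast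
    then have e: "e(Suc r := e0) ` {1..Suc r} = edges - E" by (simp only: I image_insert fun_upd_same im C(3))
    have pred: "i - 1 \<noteq> Suc r" if "i \<in> {1..Suc r}" for i using that by auto
    define C' where "C' = C(Suc r := residual E)"
    define a' where "a' = a(Suc r := a0)"
    define e' where "e' = e(Suc r := e0)"
    have "C' 0 = A" "C' (Suc r) = residual E" by (simp_all add: C'_def C(1))
    moreover have "e' ` {1..Suc r} = edges - E" using e by (simp only: e'_def)
    moreover have "\<forall>i\<le>Suc r. \<forall>m\<in>C' i. \<forall>t. m + t \<in> C' i"
      using C(4) up by (simp add: C'_def le_Suc_eq)
    moreover have "\<forall>i\<in>{1..Suc r}. C' (i - 1) \<subseteq> C' i \<and> C' i - C' (i - 1) = {a' i + t |t. Poly_Mapping.keys t \<subseteq> e' i}"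
    proof
      fix i assume i: "i \<in> {1..Suc r}"
      show "C' (i - 1) \<subseteq> C' i \<and> C' i - C' (i - 1) = {a' i + t |t. Poly_Mapping.keys t \<subseteq> e' i}"
        using i C(2) C(5)[rule_format, of i] sub d pred[OF i] unfolding C'_def a'_def e'_def
        by (cases "i = Suc r") simp_all
    qed
    ultimately show ?thesis
      by - (rule exI[of _ "Suc r"], rule exI[of _ C'], rule exI[of _ e'], rule exI[of _ a'], intro conjI; assumption)
  qed
qed

end


section \<open>Quotient modules\<close>

context module
begin

lemma abelian_subgroup_of_submodule:
  assumes "submodule N R M"
  shows "abelian_subgroup N M"
proof (rule abelian_subgroupI3)
  show "additive_subgroup N M" using submodule.axioms(1)[OF assms] by (rule additive_subgroup.intro)
  show "abelian_group M" by (rule M.abelian_group_axioms)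
qed

lemma submodule_subset: "submodule N R M \<Longrightarrow> x \<in> N \<Longrightarrow> x \<in> carrier M"
  using submoduleE(1) by blast

lemma carrier_quotient_module: "carrier (quotient_module M N) = (\<lambda>x. N +>\<^bsub>M\<^esub> x) ` carrier M"
  by (auto simp: quotient_module_def A_RCOSETS_def')

lemma zero_quotient_module: "\<zero>\<^bsub>quotient_module M N\<^esub> = N"
  by (simp add: quotient_module_def)

lemma add_quotient_module:
  assumes "submodule N R M" "x \<in> carrier M" "y \<in> carrier M"
  shows "(N +>\<^bsub>M\<^esub> x) \<oplus>\<^bsub>quotient_module M N\<^esub> (N +>\<^bsub>M\<^esub> y) = N +>\<^bsub>M\<^esub> (x \<oplus>\<^bsub>M\<^esub> y)"
  using abelian_subgroup.a_rcos_sum[OF abelian_subgroup_of_submodule[OF assms(1)] assms(2,3)]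
  by (simp add: quotient_module_def)

lemma coset_eq_self_iff:
  assumes "submodule N R M" "x \<in> carrier M"
  shows "N +>\<^bsub>M\<^esub> x = N \<longleftrightarrow> x \<in> N"
proof -
  interpret N: abelian_subgroup N M by (rule abelian_subgroup_of_submodule[OF assms(1)])
  show ?thesis
    using N.a_rcos_self[OF assms(2)] N.a_rcos_const[of x] by blast
qed

lemma coset_absorb:
  assumes "submodule N R M" "x \<in> carrier M" "n \<in> N"
  shows "N +>\<^bsub>M\<^esub> (n \<oplus>\<^bsub>M\<^esub> x) = N +>\<^bsub>M\<^esub> x"
proof -
  interpret N: abelian_subgroup N M by (rule abelian_subgroup_of_submodule[OF assms(1)])
  have n: "n \<in> carrier M" using assms submodule_subset by blast
  have "N +>\<^bsub>M\<^esub> (n \<oplus>\<^bsub>M\<^esub> x) = (N +>\<^bsub>M\<^esub> n) +>\<^bsub>M\<^esub> x"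
    by (rule M.a_coset_add_assoc[symmetric]) (use N.a_subset n assms in auto)
  then show ?thesis using N.a_rcos_const[OF assms(3)] by simp
qed

text \<open>The scalar multiple of a coset is a union over all representatives; it collapses because
  each of them contributes the same coset.\<close>

lemma smult_quotient_module:
  assumes "submodule N R M" "r \<in> carrier R" "x \<in> carrier M"
  shows "r \<odot>\<^bsub>quotient_module M N\<^esub> (N +>\<^bsub>M\<^esub> x) = N +>\<^bsub>M\<^esub> (r \<odot>\<^bsub>M\<^esub> x)"
proof -
  interpret N: abelian_subgroup N M by (rule abelian_subgroup_of_submodule[OF assms(1)])
  have "N +>\<^bsub>M\<^esub> (r \<odot>\<^bsub>M\<^esub> y) = N +>\<^bsub>M\<^esub> (r \<odot>\<^bsub>M\<^esub> x)" if y: "y \<in> N +>\<^bsub>M\<^esub> x" for y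
  proof -
    obtain n where n: "n \<in> N" "y = n \<oplus>\<^bsub>M\<^esub> x" using y by (auto simp: a_r_coset_def')
    have "n \<in> carrier M" by (rule submodule_subset[OF assms(1) n(1)])
    then have "r \<odot>\<^bsub>M\<^esub> y = r \<odot>\<^bsub>M\<^esub> n \<oplus>\<^bsub>M\<^esub> r \<odot>\<^bsub>M\<^esub> x" using n assms smult_r_distr by simp
    moreover have "r \<odot>\<^bsub>M\<^esub> n \<in> N" by (rule submodule.smult_closed[OF assms(1,2) n(1)])
    ultimately show ?thesis using coset_absorb[OF assms(1) smult_closed[OF assms(2,3)]] by simp
  qed
  moreover have "x \<in> N +>\<^bsub>M\<^esub> x" by (rule N.a_rcos_self[OF assms(3)])
  ultimately have "(\<Union>y\<in>N +>\<^bsub>M\<^esub> x. N +>\<^bsub>M\<^esub> (r \<odot>\<^bsub>M\<^esub> y)) = N +>\<^bsub>M\<^esub> (r \<odot>\<^bsub>M\<^esub> x)" by blast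
  then show ?thesis by (simp add: quotient_module_def)
qed

lemma quotient_module_is_module:
  assumes N: "submodule N R M"
  shows "module R (quotient_module M N)"
proof -
  let ?Q = "quotient_module M N"
  let ?c = "\<lambda>x. N +>\<^bsub>M\<^esub> x"
  have zero: "\<zero>\<^bsub>?Q\<^esub> = ?c \<zero>\<^bsub>M\<^esub>"
    using coset_eq_self_iff[OF N M.zero_closed] submoduleE(1,2)[OF N] submodule.axioms(1)[OF N]
    by (metis N additive_subgroup.intro additive_subgroup.zero_closed zero_quotient_module)
  show ?thesis
  proof (rule moduleI)
    show "abelian_group ?Q"
    proof (rule abelian_groupI)
      fix Y assume "Y \<in> carrier ?Q"
      then obtain x where x: "x \<in> carrier M" "Y = ?c x" by (auto simp: carrier_quotient_module)
      show "\<exists>Z\<in>carrier ?Q. Z \<oplus>\<^bsub>?Q\<^esub> Y = \<zero>\<^bsub>?Q\<^esub>"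
        unfolding zero
        by (rule bexI[of _ "?c (\<ominus>\<^bsub>M\<^esub> x)"]) (use x in \<open>auto simp: carrier_quotient_module add_quotient_module[OF N] M.l_neg\<close>)
    qed (auto simp: carrier_quotient_module add_quotient_module[OF N] zero M.a_ac)
  qed (auto simp: carrier_quotient_module add_quotient_module[OF N] smult_quotient_module[OF N] R.is_cring
        smult_l_distr smult_r_distr smult_assoc1)
qed

lemma nonzerodivisor_quotient_module:
  assumes N: "submodule N R M" and f: "f \<in> carrier R"
  shows "nonzerodivisor (quotient_module M N) f \<longleftrightarrow> (\<forall>x\<in>carrier M. f \<odot>\<^bsub>M\<^esub> x \<in> N \<longrightarrow> x \<in> N)"
  using f by (simp add: nonzerodivisor_def carrier_quotient_module zero_quotient_module
      smult_quotient_module[OF N] coset_eq_self_iff[OF N])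

lemma seq_mult_Nil: "seq_mult M [] = {\<zero>\<^bsub>M\<^esub>}"
  by (simp add: seq_mult_def)

lemma seq_mult_singleton:
  assumes "f \<in> carrier R"
  shows "seq_mult M [f] = {f \<odot>\<^bsub>M\<^esub> x |x. x \<in> carrier M}"
proof -
  have eq: "(\<Oplus>\<^bsub>M\<^esub>j\<in>{..<length [f]}. [f] ! j \<odot>\<^bsub>M\<^esub> x j) = f \<odot>\<^bsub>M\<^esub> x 0" if "x (0::nat) \<in> carrier M" for x
  proof -
    have "{..<length [f]} = insert 0 {}" by auto
    then show ?thesis using that assms by (simp only:) (simp add: M.finsum_insert)
  qed
  show ?thesis
  proof (intro equalityI subsetI)
    fix y assume "y \<in> seq_mult M [f]"
    then obtain x where x: "x \<in> {..<length [f]} \<rightarrow> carrier M" "y = (\<Oplus>\<^bsub>M\<^esub>j\<in>{..<length [f]}. [f] ! j \<odot>\<^bsub>M\<^esub> x j)"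
      unfolding seq_mult_def by blast
    have "x 0 \<in> carrier M" using x(1) by auto
    then show "y \<in> {f \<odot>\<^bsub>M\<^esub> x |x. x \<in> carrier M}" using eq x(2) by blast
  next
    fix y assume "y \<in> {f \<odot>\<^bsub>M\<^esub> x |x. x \<in> carrier M}"
    then obtain x where x: "x \<in> carrier M" "y = f \<odot>\<^bsub>M\<^esub> x" by blast
    then have "y = (\<Oplus>\<^bsub>M\<^esub>j\<in>{..<length [f]}. [f] ! j \<odot>\<^bsub>M\<^esub> (\<lambda>_. x) j)" using eq[of "\<lambda>_. x"] by simp
    moreover have "(\<lambda>_. x) \<in> {..<length [f]} \<rightarrow> carrier M" using x by simp
    ultimately show "y \<in> seq_mult M [f]" unfolding seq_mult_def by (intro CollectI exI[of _ "\<lambda>_. x"] conjI)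
  qed
qed

lemma submodule_smult_image:
  assumes f: "f \<in> carrier R"
  shows "submodule {f \<odot>\<^bsub>M\<^esub> x |x. x \<in> carrier M} R M"
proof (rule submoduleI)
  show "\<zero>\<^bsub>M\<^esub> \<in> {f \<odot>\<^bsub>M\<^esub> x |x. x \<in> carrier M}" using f smult_r_null M.zero_closed by force
next
  fix a assume "a \<in> {f \<odot>\<^bsub>M\<^esub> x |x. x \<in> carrier M}"
  then show "\<ominus>\<^bsub>M\<^esub> a \<in> {f \<odot>\<^bsub>M\<^esub> x |x. x \<in> carrier M}" using f smult_r_minus[of f] M.a_inv_closed by fastforce
next
  fix a b assume "a \<in> {f \<odot>\<^bsub>M\<^esub> x |x. x \<in> carrier M}" "b \<in> {f \<odot>\<^bsub>M\<^esub> x |x. x \<in> carrier M}"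
  then obtain x y where "x \<in> carrier M" "y \<in> carrier M" "a = f \<odot>\<^bsub>M\<^esub> x" "b = f \<odot>\<^bsub>M\<^esub> y" by blast
  then show "a \<oplus>\<^bsub>M\<^esub> b \<in> {f \<odot>\<^bsub>M\<^esub> x |x. x \<in> carrier M}"
    using f by (intro CollectI exI[of _ "x \<oplus>\<^bsub>M\<^esub> y"]) (simp add: smult_r_distr)
next
  fix r a assume "r \<in> carrier R" "a \<in> {f \<odot>\<^bsub>M\<^esub> x |x. x \<in> carrier M}"
  then obtain x where x: "x \<in> carrier M" "a = f \<odot>\<^bsub>M\<^esub> x" "r \<in> carrier R" by blast
  then have "r \<odot>\<^bsub>M\<^esub> a = f \<odot>\<^bsub>M\<^esub> (r \<odot>\<^bsub>M\<^esub> x)"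
    using f smult_assoc1[of r f x] smult_assoc1[of f r x] R.m_comm[of f r] by simp
  then show "r \<odot>\<^bsub>M\<^esub> a \<in> {f \<odot>\<^bsub>M\<^esub> x |x. x \<in> carrier M}" using x by blast
qed (use f in auto)

lemma submodule_zero: "submodule {\<zero>\<^bsub>M\<^esub>} R M"
  by (rule submoduleI) auto

text \<open>The form in which depth two enters: injectivity of \<open>f\<close> on \<open>M\<close>
  and of \<open>g\<close> on \<open>M/fM\<close>, stated with elements of \<open>M\<close> in place
  of cosets.\<close>

lemma regular_sequence_pair:
  assumes "regular_sequence R M (f # g # fs)"
  shows "x \<in> carrier M \<Longrightarrow> f \<odot>\<^bsub>M\<^esub> x = \<zero>\<^bsub>M\<^esub> \<Longrightarrow> x = \<zero>\<^bsub>M\<^esub>"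
    and "\<lbrakk>x \<in> carrier M; y \<in> carrier M; g \<odot>\<^bsub>M\<^esub> x = f \<odot>\<^bsub>M\<^esub> y\<rbrakk> \<Longrightarrow> \<exists>z\<in>carrier M. x = f \<odot>\<^bsub>M\<^esub> z"
proof -
  have fg: "f \<in> carrier R" "g \<in> carrier R" using assms by (auto simp: regular_sequence_def)
  have reg: "\<And>i. i < length (f # g # fs) \<Longrightarrow>
      nonzerodivisor (quotient_module M (seq_mult M (take i (f # g # fs)))) ((f # g # fs) ! i)"
    using assms unfolding regular_sequence_def by blast
  have f: "nonzerodivisor (quotient_module M {\<zero>\<^bsub>M\<^esub>}) f"
    using reg[of 0] by (simp add: seq_mult_Nil)
  have g: "nonzerodivisor (quotient_module M {f \<odot>\<^bsub>M\<^esub> x |x. x \<in> carrier M}) g"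
    using reg[of 1] by (simp add: seq_mult_singleton[OF fg(1)])
  show "x \<in> carrier M \<Longrightarrow> f \<odot>\<^bsub>M\<^esub> x = \<zero>\<^bsub>M\<^esub> \<Longrightarrow> x = \<zero>\<^bsub>M\<^esub>"
    using f unfolding nonzerodivisor_quotient_module[OF submodule_zero fg(1)] by simp
  show "\<lbrakk>x \<in> carrier M; y \<in> carrier M; g \<odot>\<^bsub>M\<^esub> x = f \<odot>\<^bsub>M\<^esub> y\<rbrakk> \<Longrightarrow> \<exists>z\<in>carrier M. x = f \<odot>\<^bsub>M\<^esub> z"
    using g unfolding nonzerodivisor_quotient_module[OF submodule_smult_image[OF fg(1)] fg(2)] by blast
qed

end

text \<open>The factors of the filtration are reached by a map out of \<open>S/P\<close>, whereas
  \<open>multigraded_isomorphic\<close> asks for one in the opposite direction.\<close>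

lemma module_iso_inverse:
  assumes "module R M" "module R L" and h: "h \<in> module_iso R M L"
  shows "inv_into (carrier M) h \<in> module_iso R L M"
proof -
  interpret M: module R M by fact
  interpret L: module R L by fact
  have bij: "bij_betw h (carrier M) (carrier L)" using h by (simp add: module_iso_def)
  let ?g = "inv_into (carrier M) h"
  have inv: "\<And>x. x \<in> carrier M \<Longrightarrow> ?g (h x) = x" "\<And>y. y \<in> carrier L \<Longrightarrow> h (?g y) = y"
    "\<And>y. y \<in> carrier L \<Longrightarrow> ?g y \<in> carrier M"
    using bij by (auto simp: bij_betw_def f_inv_into_f inv_into_into)
  have "?g (x \<oplus>\<^bsub>L\<^esub> y) = ?g x \<oplus>\<^bsub>M\<^esub> ?g y" if "x \<in> carrier L" "y \<in> carrier L" for x y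
  proof -
    have "h (?g x \<oplus>\<^bsub>M\<^esub> ?g y) = x \<oplus>\<^bsub>L\<^esub> y" using h that inv by (simp add: module_iso_def)
    then show ?thesis using inv(1)[of "?g x \<oplus>\<^bsub>M\<^esub> ?g y"] inv(3) that by simp
  qed
  moreover have "?g (r \<odot>\<^bsub>L\<^esub> x) = r \<odot>\<^bsub>M\<^esub> ?g x" if "x \<in> carrier L" "r \<in> carrier R" for x r
  proof -
    have "h (r \<odot>\<^bsub>M\<^esub> ?g x) = r \<odot>\<^bsub>L\<^esub> x" using h that inv by (simp add: module_iso_def)
    then show ?thesis using inv(1)[of "r \<odot>\<^bsub>M\<^esub> ?g x"] inv(3) that by simp
  qed
  ultimately show ?thesis using bij_betw_inv_into[OF bij] by (simp add: module_iso_def)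
qed

text \<open>The values of \<open>h\<close> on cosets are part of the conclusion, because the images
  of the graded components are computed from them.\<close>

lemma first_isomorphism_theorem:
  assumes "module R M" "module R L"
    and closed: "\<And>x. x \<in> carrier M \<Longrightarrow> \<theta> x \<in> carrier L"
    and add: "\<And>x y. \<lbrakk>x \<in> carrier M; y \<in> carrier M\<rbrakk> \<Longrightarrow> \<theta> (x \<oplus>\<^bsub>M\<^esub> y) = \<theta> x \<oplus>\<^bsub>L\<^esub> \<theta> y"
    and smult: "\<And>r x. \<lbrakk>r \<in> carrier R; x \<in> carrier M\<rbrakk> \<Longrightarrow> \<theta> (r \<odot>\<^bsub>M\<^esub> x) = r \<odot>\<^bsub>L\<^esub> \<theta> x"
    and surj: "\<theta> ` carrier M = carrier L"
    and K: "submodule K R M" "\<And>x. x \<in> carrier M \<Longrightarrow> \<theta> x = \<zero>\<^bsub>L\<^esub> \<longleftrightarrow> x \<in> K"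
  shows "\<exists>h\<in>module_iso R (quotient_module M K) L. \<forall>x\<in>carrier M. h (K +>\<^bsub>M\<^esub> x) = \<theta> x"
proof -
  interpret M: module R M by fact
  interpret L: module R L by fact
  interpret K: abelian_subgroup K M by (rule M.abelian_subgroup_of_submodule[OF K(1)])
  have eq: "\<theta> x = \<theta> y \<longleftrightarrow> K +>\<^bsub>M\<^esub> x = K +>\<^bsub>M\<^esub> y" if "x \<in> carrier M" "y \<in> carrier M" for x y
  proof
    define d where "d = x \<oplus>\<^bsub>M\<^esub> \<ominus>\<^bsub>M\<^esub> y"
    have d: "d \<in> carrier M" "x = d \<oplus>\<^bsub>M\<^esub> y" using that by (simp_all add: d_def M.M.a_assoc M.M.l_neg)
    then have td: "\<theta> x = \<theta> d \<oplus>\<^bsub>L\<^esub> \<theta> y" using add that by blast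
    show "K +>\<^bsub>M\<^esub> x = K +>\<^bsub>M\<^esub> y" if "\<theta> x = \<theta> y"
    proof -
      have "\<theta> d = \<zero>\<^bsub>L\<^esub>" using td that closed d \<open>y \<in> carrier M\<close> by (metis L.M.add.r_cancel_one)
      then have "d \<in> K" using K(2) d by blast
      then show ?thesis using M.coset_absorb[OF K(1) \<open>y \<in> carrier M\<close>] d by simp
    qed
    show "\<theta> x = \<theta> y" if "K +>\<^bsub>M\<^esub> x = K +>\<^bsub>M\<^esub> y"
    proof -
      have "x \<in> K +>\<^bsub>M\<^esub> y" using K.a_rcos_self[OF \<open>x \<in> carrier M\<close>] that by simp
      then obtain k where k: "k \<in> K" "x = k \<oplus>\<^bsub>M\<^esub> y" by (auto simp: a_r_coset_def')
      then have "\<theta> x = \<theta> k \<oplus>\<^bsub>L\<^esub> \<theta> y" using add K.a_Hcarr \<open>y \<in> carrier M\<close> by blast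
      moreover have "\<theta> k = \<zero>\<^bsub>L\<^esub>" using K k K.a_Hcarr by blast
      ultimately show ?thesis using closed \<open>y \<in> carrier M\<close> by simp
    qed
  qed
  \<comment> \<open>The value is read off at a chosen representative; \<open>eq\<close> makes the
    choice immaterial.\<close>
  define h where "h Y = \<theta> (SOME x. x \<in> carrier M \<and> Y = K +>\<^bsub>M\<^esub> x)" for Y
  have h: "h (K +>\<^bsub>M\<^esub> x) = \<theta> x" if x: "x \<in> carrier M" for x
  proof -
    have "\<exists>y. y \<in> carrier M \<and> K +>\<^bsub>M\<^esub> x = K +>\<^bsub>M\<^esub> y" using x by blast
    from someI_ex[OF this] show ?thesis unfolding h_def using eq x by metis
  qed
  have "inj_on h (carrier (quotient_module M K))"
    by (rule inj_onI) (auto simp: M.carrier_quotient_module h eq)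
  moreover have "h ` carrier (quotient_module M K) = carrier L"
    using surj h by (simp add: M.carrier_quotient_module image_image)
  ultimately have "h \<in> module_iso R (quotient_module M K) L"
    by (auto simp: module_iso_def bij_betw_def M.carrier_quotient_module h
        M.add_quotient_module[OF K(1)] M.smult_quotient_module[OF K(1)] add smult)
  then show ?thesis using h by blast
qed


section \<open>Monomial ideals as upward closed sets of exponents\<close>

lemma mpoly_ring_simps [simp]:
  "carrier mpoly_ring = UNIV" "x \<otimes>\<^bsub>mpoly_ring\<^esub> y = x * y" "x \<oplus>\<^bsub>mpoly_ring\<^esub> y = x + y"
  "\<zero>\<^bsub>mpoly_ring\<^esub> = 0" "\<one>\<^bsub>mpoly_ring\<^esub> = 1"
  by (simp_all add: mpoly_ring_def ring_of_type_algebra_def)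

lemma cring_mpoly_ring: "cring mpoly_ring"
  unfolding mpoly_ring_def by (rule cring_from_type_algebra)

lemma nat_pow_mpoly_ring: "x [^]\<^bsub>mpoly_ring\<^esub> (k::nat) = x ^ k"
proof -
  interpret cring mpoly_ring by (rule cring_mpoly_ring)
  show ?thesis by (induction k) (simp_all add: mult.commute)
qed

lemma a_inv_mpoly_ring: "\<ominus>\<^bsub>mpoly_ring\<^esub> x = - x"
proof -
  interpret cring mpoly_ring by (rule cring_mpoly_ring)
  show ?thesis by (rule minus_equality) simp_all
qed

text \<open>The \<open>K\<close>-linear span of the monomials with exponent in \<open>C\<close>. For
  upward closed \<open>C\<close> it is an ideal, and questions about monomial ideals become
  questions about sets of exponents.\<close>

definition monomial_span :: "('n \<Rightarrow>\<^sub>0 nat) set \<Rightarrow> ('n, 'k::zero) mpoly set" where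
  "monomial_span C = {p. Poly_Mapping.keys p \<subseteq> C}"

lemma monomial_spanD: "p \<in> monomial_span C \<Longrightarrow> m \<in> Poly_Mapping.keys p \<Longrightarrow> m \<in> C"
  by (auto simp: monomial_span_def)

lemma monomial_span_mono: "C \<subseteq> D \<Longrightarrow> monomial_span C \<subseteq> monomial_span D"
  by (auto simp: monomial_span_def)

lemma single_mem_monomial_span [simp]:
  "Poly_Mapping.single m (1::'k::zero_neq_one) \<in> monomial_span C \<longleftrightarrow> m \<in> C"
  by (simp add: monomial_span_def)

lemma zero_mem_monomial_span [simp]: "0 \<in> monomial_span C"
  by (simp add: monomial_span_def)

lemma add_mem_monomial_span: "p \<in> monomial_span C \<Longrightarrow> q \<in> monomial_span C \<Longrightarrow> p + q \<in> monomial_span C"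
  using keys_add[of p q] by (auto simp: monomial_span_def)

lemma uminus_mem_monomial_span: "p \<in> monomial_span C \<Longrightarrow> - p \<in> monomial_span C" for p :: "('n, 'k::field) mpoly"
  by (simp add: monomial_span_def in_keys_iff subset_iff)

lemma mult_mem_monomial_span:
  assumes "\<And>m t. m \<in> C \<Longrightarrow> m + t \<in> C" "p \<in> monomial_span C"
  shows "r * p \<in> monomial_span C"
  unfolding monomial_span_def
proof (intro CollectI subsetI)
  fix m assume "m \<in> Poly_Mapping.keys (r * p)"
  then obtain a b where b: "b \<in> Poly_Mapping.keys p" "m = a + b" using keys_mult[of r p] by blast
  show "m \<in> C" unfolding b(2) add.commute[of a] by (rule assms(1), rule monomial_spanD[OF assms(2) b(1)])
qed

lemma poly_mapping_eq_sum_single: "p = (\<Sum>m\<in>Poly_Mapping.keys p. Poly_Mapping.single m (Poly_Mapping.lookup p m))"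
proof (rule poly_mapping_eqI)
  fix k
  have "(\<Sum>m\<in>Poly_Mapping.keys p. Poly_Mapping.lookup p m when m = k) = (Poly_Mapping.lookup p k when k \<in> Poly_Mapping.keys p)"
    by (simp add: when_def sum.delta')
  then show "Poly_Mapping.lookup p k = Poly_Mapping.lookup (\<Sum>m\<in>Poly_Mapping.keys p. Poly_Mapping.single m (Poly_Mapping.lookup p m)) k"
    by (simp add: lookup_sum lookup_single when_def in_keys_iff)
qed

lemma ideal_monomial_span:
  fixes C :: "('n::finite \<Rightarrow>\<^sub>0 nat) set"
  assumes "\<And>m t. m \<in> C \<Longrightarrow> m + t \<in> C"
  shows "ideal (monomial_span C :: ('n, 'k::field) mpoly set) mpoly_ring"
proof -
  interpret cring "mpoly_ring :: ('n, 'k) mpoly ring" by (rule cring_mpoly_ring)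
  show ?thesis
  proof (rule idealI)
    show "ring (mpoly_ring :: ('n, 'k) mpoly ring)" by (rule ring_axioms)
    show "subgroup (monomial_span C :: ('n, 'k) mpoly set) (add_monoid mpoly_ring)"
    proof (rule add.subgroupI)
      show "monomial_span C \<noteq> ({} :: ('n, 'k) mpoly set)" using zero_mem_monomial_span by blast
      show "\<ominus>\<^bsub>mpoly_ring\<^esub> a \<in> monomial_span C" if "a \<in> monomial_span C" for a :: "('n, 'k) mpoly"
        using uminus_mem_monomial_span[OF that] a_inv_mpoly_ring[of a] by simp
    qed (use add_mem_monomial_span in simp_all)
  next
    fix a x :: "('n, 'k) mpoly"
    assume a: "a \<in> monomial_span C"
    show "x \<otimes>\<^bsub>mpoly_ring\<^esub> a \<in> monomial_span C" using mult_mem_monomial_span[OF assms a] by simp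
    show "a \<otimes>\<^bsub>mpoly_ring\<^esub> x \<in> monomial_span C" using mult_mem_monomial_span[OF assms a, of x] by (simp add: mult.commute)
  qed
qed

lemma genideal_monomials:
  fixes C :: "('n::finite \<Rightarrow>\<^sub>0 nat) set"
  shows "Idl\<^bsub>mpoly_ring\<^esub> ((\<lambda>m. Poly_Mapping.single m (1::'k::field)) ` C) = monomial_span {a + t |a t. a \<in> C}"
    (is "Idl\<^bsub>_\<^esub> ?G = monomial_span ?D")
proof -
  interpret cring "mpoly_ring :: ('n, 'k) mpoly ring" by (rule cring_mpoly_ring)
  interpret J: ideal "Idl\<^bsub>mpoly_ring\<^esub> ?G" mpoly_ring by (rule genideal_ideal) simp
  show ?thesis
  proof
    show "Idl\<^bsub>mpoly_ring\<^esub> ?G \<subseteq> monomial_span ?D"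
    proof (rule genideal_minimal)
      show "ideal (monomial_span ?D) mpoly_ring"
      proof (rule ideal_monomial_span)
        fix m t assume "m \<in> ?D"
        then obtain a s where "a \<in> C" "m = a + s" by blast
        then show "m + t \<in> ?D" by (intro CollectI exI[of _ a] exI[of _ "s + t"]) (simp add: add.assoc)
      qed
      show "?G \<subseteq> monomial_span ?D"
      proof
        fix p assume "p \<in> ?G"
        then obtain m where "p = Poly_Mapping.single m 1" "m \<in> C" by blast
        moreover have "m \<in> ?D" by (intro CollectI exI[of _ m] exI[of _ 0]) (use \<open>m \<in> C\<close> in simp)
        ultimately show "p \<in> monomial_span ?D" by simp
      qed
    qed
    have sum: "sum f Y \<in> Idl\<^bsub>mpoly_ring\<^esub> ?G" if "finite Y" "\<And>x. x \<in> Y \<Longrightarrow> f x \<in> Idl\<^bsub>mpoly_ring\<^esub> ?G"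
      for Y and f :: "('n \<Rightarrow>\<^sub>0 nat) \<Rightarrow> ('n, 'k) mpoly"
      using that
    proof (induction Y rule: finite_induct)
      case empty
      show ?case using J.zero_closed by simp
    next
      case (insert x Y)
      then show ?case using J.a_closed[of "f x" "sum f Y"] by simp
    qed
    show "monomial_span ?D \<subseteq> Idl\<^bsub>mpoly_ring\<^esub> ?G"
    proof
      fix p :: "('n, 'k) mpoly" assume p: "p \<in> monomial_span ?D"
      show "p \<in> Idl\<^bsub>mpoly_ring\<^esub> ?G"
      proof (subst poly_mapping_eq_sum_single, rule sum)
        fix m assume "m \<in> Poly_Mapping.keys p"
        then obtain a t where at: "a \<in> C" "m = a + t" using monomial_spanD[OF p] by blast
        have "Poly_Mapping.single a 1 \<in> Idl\<^bsub>mpoly_ring\<^esub> ?G"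
          using genideal_self[of ?G] at(1) by auto
        then have "Poly_Mapping.single t (Poly_Mapping.lookup p m) \<otimes>\<^bsub>mpoly_ring\<^esub> Poly_Mapping.single a 1 \<in> Idl\<^bsub>mpoly_ring\<^esub> ?G"
          by (rule J.I_l_closed) simp
        then show "Poly_Mapping.single m (Poly_Mapping.lookup p m) \<in> Idl\<^bsub>mpoly_ring\<^esub> ?G"
          by (simp add: mult_single at(2) add.commute)
      qed simp
    qed
  qed
qed

lemma monomial_idealE:
  fixes I :: "('n::finite, 'k::field) mpoly set"
  assumes "monomial_ideal I"
  obtains C where "I = monomial_span C" "\<And>m t. m \<in> C \<Longrightarrow> m + t \<in> C"
proof -
  obtain G where G: "I = Idl\<^bsub>mpoly_ring\<^esub> ((\<lambda>m. Poly_Mapping.single m 1) ` G)"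
    using assms by (auto simp: monomial_ideal_def)
  show ?thesis
  proof (rule that)
    show "I = monomial_span {a + t |a t. a \<in> G}" by (simp add: G genideal_monomials)
    fix m t assume "m \<in> {a + t |a t. a \<in> G}"
    then obtain a s where "a \<in> G" "m = a + s" by blast
    then show "m + t \<in> {a + t |a t. a \<in> G}" by (intro CollectI exI[of _ a] exI[of _ "s + t"]) (simp add: add.assoc)
  qed
qed

lemma monomial_ideal_monomial_span:
  fixes C :: "('n::finite \<Rightarrow>\<^sub>0 nat) set"
  assumes "\<And>m t. m \<in> C \<Longrightarrow> m + t \<in> C"
  shows "monomial_ideal (monomial_span C :: ('n, 'k::field) mpoly set)"
proof -
  have "C \<subseteq> {a + t |a t. a \<in> C}"
  proof
    fix m assume "m \<in> C"
    then show "m \<in> {a + t |a t. a \<in> C}" by (intro CollectI exI[of _ m] exI[of _ 0]) simp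
  qed
  moreover have "{a + t |a t. a \<in> C} \<subseteq> C" using assms by auto
  ultimately have "C = {a + t |a t. a \<in> C}" by (rule equalityI)
  then show ?thesis
    unfolding monomial_ideal_def using genideal_monomials[of C, where ?'k = 'k, symmetric] by auto
qed

lemma monomial_power:
  fixes m :: "'n \<Rightarrow>\<^sub>0 nat"
  shows "\<exists>e. (Poly_Mapping.single m (1::'k::field)) ^ k = Poly_Mapping.single e 1 \<and>
    (\<forall>i. Poly_Mapping.lookup e i = k * Poly_Mapping.lookup m i)"
proof (induction k)
  case 0
  show ?case by (intro exI[of _ 0]) simp
next
  case (Suc k)
  then obtain e where e: "(Poly_Mapping.single m (1::'k)) ^ k = Poly_Mapping.single e 1"
    "\<And>i. Poly_Mapping.lookup e i = k * Poly_Mapping.lookup m i" by blast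
  show ?case by (intro exI[of _ "m + e"]) (simp add: e mult_single lookup_add)
qed

text \<open>If the support of \<open>m'\<close> contains that of \<open>m\<close>, then a high power
  of the monomial of \<open>m'\<close> is a multiple of the monomial of \<open>m\<close>.\<close>

lemma radical_monomial_span_keys:
  fixes C :: "('n::finite \<Rightarrow>\<^sub>0 nat) set"
  assumes up: "\<And>m t. m \<in> C \<Longrightarrow> m + t \<in> C"
    and rad: "radical_ideal mpoly_ring (monomial_span C :: ('n, 'k::field) mpoly set)"
    and m: "m \<in> C" "Poly_Mapping.keys m \<subseteq> Poly_Mapping.keys m'"
  shows "m' \<in> C"
proof -
  \<comment> \<open>The total degree of \<open>m\<close> bounds each of its exponents, so this power
    is high enough.\<close>
  define k where "k = (\<Sum>i\<in>UNIV. Poly_Mapping.lookup m i)"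
  obtain e where e: "(Poly_Mapping.single m' (1::'k)) ^ k = Poly_Mapping.single e 1"
    "\<And>i. Poly_Mapping.lookup e i = k * Poly_Mapping.lookup m' i" using monomial_power by blast
  have "Poly_Mapping.lookup m i \<le> Poly_Mapping.lookup e i" for i
  proof (cases "i \<in> Poly_Mapping.keys m")
    case True
    then have "1 \<le> Poly_Mapping.lookup m' i" using m(2) by (metis One_nat_def Suc_leI gr0I in_keys_iff subsetD)
    moreover have "Poly_Mapping.lookup m i \<le> k" unfolding k_def by (rule member_le_sum) simp_all
    ultimately show ?thesis unfolding e(2) by (metis mult.right_neutral mult_le_mono)
  qed (simp add: in_keys_iff)
  then have "e = m + (e - m)" by (rule exponent_eq_add_diff)
  then have "e \<in> C" using up[OF m(1)] by metis
  then have "Poly_Mapping.single m' (1::'k) [^]\<^bsub>mpoly_ring\<^esub> k \<in> monomial_span C"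
    by (simp add: nat_pow_mpoly_ring e(1))
  then have "Poly_Mapping.single m' (1::'k) \<in> monomial_span C"
    using rad unfolding radical_ideal_def mpoly_ring_simps by blast
  then show ?thesis unfolding single_mem_monomial_span .
qed


section \<open>The monomial prime ideals\<close>

text \<open>The index type \<open>'n\<close> carries no order, but it injects into
  \<open>nat\<close>, and exponents in \<open>nat \<Rightarrow>\<^sub>0 nat\<close> have a linear
  order compatible with addition. Pulling it back gives a way to choose leading terms.\<close>

lemma exists_additive_order_embedding:
  "\<exists>\<phi> :: ('n::finite \<Rightarrow>\<^sub>0 nat) \<Rightarrow> (nat \<Rightarrow>\<^sub>0 nat). inj \<phi> \<and> (\<forall>a b. \<phi> (a + b) = \<phi> a + \<phi> b)"
proof -
  obtain f :: "'n \<Rightarrow> nat" where f: "inj f"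
    using finite_imp_inj_to_nat_seg[of "UNIV :: 'n set"] by auto
  define \<phi> where "\<phi> m = (\<Sum>i\<in>UNIV. Poly_Mapping.single (f i) (Poly_Mapping.lookup m i))" for m :: "'n \<Rightarrow>\<^sub>0 nat"
  have l: "Poly_Mapping.lookup (\<phi> m) (f j) = Poly_Mapping.lookup m j" for m j
    by (simp add: \<phi>_def lookup_sum lookup_single when_def inj_eq[OF f] sum.delta')
  have "inj \<phi>" by (rule injI, rule poly_mapping_eqI) (metis l)
  moreover have "\<phi> (a + b) = \<phi> a + \<phi> b" for a b
    by (simp add: \<phi>_def lookup_add single_add sum.distrib)
  ultimately show ?thesis by blast
qed

text \<open>The prime generated by the variables outside \<open>F\<close>; modulo it, the polynomial
  ring in the variables of \<open>F\<close> remains. Larger \<open>F\<close> give smaller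
  primes.\<close>

definition monomial_prime :: "'n set \<Rightarrow> ('n, 'k::zero) mpoly set" where
  "monomial_prime F = monomial_span {m. \<not> Poly_Mapping.keys m \<subseteq> F}"

lemma monomial_prime_up: "m \<in> {m. \<not> Poly_Mapping.keys m \<subseteq> F} \<Longrightarrow> m + t \<in> {m. \<not> Poly_Mapping.keys (m :: 'n \<Rightarrow>\<^sub>0 nat) \<subseteq> F}"
  by (auto simp: keys_add_nat)

lemma monomial_ideal_monomial_prime: "monomial_ideal (monomial_prime F :: ('n::finite, 'k::field) mpoly set)"
  unfolding monomial_prime_def by (rule monomial_ideal_monomial_span) (rule monomial_prime_up)

lemma ideal_monomial_prime: "ideal (monomial_prime F :: ('n::finite, 'k::field) mpoly set) mpoly_ring"
  unfolding monomial_prime_def by (rule ideal_monomial_span) (rule monomial_prime_up)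

lemma monomial_prime_subset_iff:
  "monomial_prime F \<subseteq> (monomial_prime G :: ('n::finite, 'k::field) mpoly set) \<longleftrightarrow> G \<subseteq> F"
proof
  assume L: "monomial_prime F \<subseteq> (monomial_prime G :: ('n, 'k) mpoly set)"
  show "G \<subseteq> F"
  proof
    fix i assume i: "i \<in> G"
    show "i \<in> F"
    proof (rule ccontr)
      assume "i \<notin> F"
      then have "Poly_Mapping.single (var i) (1::'k) \<in> monomial_prime F" by (simp add: monomial_prime_def)
      then have "Poly_Mapping.single (var i) (1::'k) \<in> monomial_prime G" using L by blast
      then show False using i by (simp add: monomial_prime_def)
    qed
  qed
next
  assume "G \<subseteq> F"
  then show "monomial_prime F \<subseteq> (monomial_prime G :: ('n, 'k) mpoly set)"
    unfolding monomial_prime_def by (intro monomial_span_mono) auto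
qed

text \<open>Order exponents by an additive embedding into a linearly ordered monoid; the product of the
  leading terms supported on \<open>F\<close> of two polynomials outside the ideal does not cancel.\<close>

lemma primeideal_monomial_prime: "primeideal (monomial_prime F :: ('n::finite, 'k::field) mpoly set) mpoly_ring"
proof (rule primeidealI)
  show "ideal (monomial_prime F :: ('n, 'k) mpoly set) mpoly_ring" by (rule ideal_monomial_prime)
  show "cring (mpoly_ring :: ('n, 'k) mpoly ring)" by (rule cring_mpoly_ring)
  have "Poly_Mapping.single 0 (1::'k) \<notin> monomial_prime F"
    unfolding monomial_prime_def single_mem_monomial_span by simp
  then show "carrier mpoly_ring \<noteq> (monomial_prime F :: ('n, 'k) mpoly set)" unfolding mpoly_ring_simps by blast
  fix p q :: "('n, 'k) mpoly"
  assume pq: "p \<otimes>\<^bsub>mpoly_ring\<^esub> q \<in> monomial_prime F"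
  show "p \<in> monomial_prime F \<or> q \<in> monomial_prime F"
  proof (rule ccontr)
    assume neg: "\<not> (p \<in> monomial_prime F \<or> q \<in> monomial_prime F)"
    obtain \<phi> :: "('n \<Rightarrow>\<^sub>0 nat) \<Rightarrow> (nat \<Rightarrow>\<^sub>0 nat)" where \<phi>: "inj \<phi>" "\<And>a b. \<phi> (a + b) = \<phi> a + \<phi> b"
      using exists_additive_order_embedding by blast
    have lead: "\<exists>m\<in>Poly_Mapping.keys r. Poly_Mapping.keys m \<subseteq> F \<and>
        (\<forall>a\<in>Poly_Mapping.keys r. Poly_Mapping.keys a \<subseteq> F \<longrightarrow> a = m \<or> \<phi> a < \<phi> m)"
      if r: "r \<notin> monomial_prime F" for r :: "('n, 'k) mpoly"
    proof -
      let ?K = "{m \<in> Poly_Mapping.keys r. Poly_Mapping.keys m \<subseteq> F}"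
      have K: "finite ?K" "?K \<noteq> {}" using r by (auto simp: monomial_prime_def monomial_span_def)
      have "Max (\<phi> ` ?K) \<in> \<phi> ` ?K" by (rule Max_in) (use K in auto)
      then obtain m where m: "m \<in> ?K" "Max (\<phi> ` ?K) = \<phi> m" by blast
      have "a = m \<or> \<phi> a < \<phi> m" if "a \<in> ?K" for a
      proof -
        have "\<phi> a \<le> \<phi> m" unfolding m(2)[symmetric] by (rule Max_ge) (use K that in auto)
        then show ?thesis using injD[OF \<phi>(1)] by (auto simp: le_less)
      qed
      then show ?thesis using m(1) by blast
    qed
    obtain m where m: "m \<in> Poly_Mapping.keys p" "Poly_Mapping.keys m \<subseteq> F"
      "\<And>a. a \<in> Poly_Mapping.keys p \<Longrightarrow> Poly_Mapping.keys a \<subseteq> F \<Longrightarrow> a = m \<or> \<phi> a < \<phi> m"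
      using lead[of p] neg by blast
    obtain n where n: "n \<in> Poly_Mapping.keys q" "Poly_Mapping.keys n \<subseteq> F"
      "\<And>a. a \<in> Poly_Mapping.keys q \<Longrightarrow> Poly_Mapping.keys a \<subseteq> F \<Longrightarrow> a = n \<or> \<phi> a < \<phi> n"
      using lead[of q] neg by blast
    \<comment> \<open>The support of \<open>m + n\<close> forces both summands to be supported on
      \<open>F\<close>, where \<open>m\<close> and \<open>n\<close> are the strictly largest
      exponents of their polynomials.\<close>
    have uniq: "a = m \<and> b = n" if ab: "a \<in> Poly_Mapping.keys p" "b \<in> Poly_Mapping.keys q" "a + b = m + n" for a b
    proof -
      have "Poly_Mapping.keys (a + b) \<subseteq> F" unfolding ab(3) keys_add_nat using m(2) n(2) by simp
      then have k: "Poly_Mapping.keys a \<subseteq> F" "Poly_Mapping.keys b \<subseteq> F" by (simp_all add: keys_add_nat)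
      have s: "\<phi> a + \<phi> b = \<phi> m + \<phi> n" using arg_cong[OF ab(3), of \<phi>] by (simp add: \<phi>(2))
      consider "a = m" | "b = n" | "\<phi> a < \<phi> m" "\<phi> b < \<phi> n" using m(3)[OF ab(1) k(1)] n(3)[OF ab(2) k(2)] by blast
      then show ?thesis
      proof cases
        case 3
        then have "\<phi> a + \<phi> b < \<phi> m + \<phi> n" by (rule add_strict_mono)
        then show ?thesis using s by simp
      qed (use ab(3) in simp_all)
    qed
    \<comment> \<open>Removing the two leading terms splits \<open>p * q\<close> into three
      summands, only one of which contains the exponent \<open>m + n\<close>.\<close>
    define p' where "p' = p - Poly_Mapping.single m (Poly_Mapping.lookup p m)"
    define q' where "q' = q - Poly_Mapping.single n (Poly_Mapping.lookup q n)"
    have p': "Poly_Mapping.keys p' \<subseteq> Poly_Mapping.keys p - {m}"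
      by (auto simp: p'_def in_keys_iff lookup_minus lookup_single when_def split: if_splits)
    have q': "Poly_Mapping.keys q' \<subseteq> Poly_Mapping.keys q - {n}"
      by (auto simp: q'_def in_keys_iff lookup_minus lookup_single when_def split: if_splits)
    have "m + n \<notin> Poly_Mapping.keys (p' * q)"
    proof
      assume "m + n \<in> Poly_Mapping.keys (p' * q)"
      then obtain a b where "a \<in> Poly_Mapping.keys p'" "b \<in> Poly_Mapping.keys q" "m + n = a + b"
        using keys_mult[of p' q] by blast
      then show False using uniq[of a b] p' by auto
    qed
    moreover have "m + n \<notin> Poly_Mapping.keys (Poly_Mapping.single m (Poly_Mapping.lookup p m) * q')"
    proof
      assume "m + n \<in> Poly_Mapping.keys (Poly_Mapping.single m (Poly_Mapping.lookup p m) * q')"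
      then obtain a b where "a \<in> Poly_Mapping.keys (Poly_Mapping.single m (Poly_Mapping.lookup p m))"
        "b \<in> Poly_Mapping.keys q'" "m + n = a + b"
        using keys_mult[of "Poly_Mapping.single m (Poly_Mapping.lookup p m)" q'] by blast
      then show False using q' by (auto split: if_splits)
    qed
    moreover have "p * q = p' * q + Poly_Mapping.single m (Poly_Mapping.lookup p m) * q'
        + Poly_Mapping.single (m + n) (Poly_Mapping.lookup p m * Poly_Mapping.lookup q n)"
      unfolding mult_single[symmetric] by (simp add: p'_def q'_def algebra_simps)
    ultimately have "Poly_Mapping.lookup (p * q) (m + n) = Poly_Mapping.lookup p m * Poly_Mapping.lookup q n"
      by (simp add: lookup_add in_keys_iff)
    then have "m + n \<in> Poly_Mapping.keys (p * q)" using m(1) n(1) by (simp add: in_keys_iff)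
    then have "\<not> Poly_Mapping.keys (m + n) \<subseteq> F"
      using pq monomial_spanD[of "p * q" "{m. \<not> Poly_Mapping.keys m \<subseteq> F}" "m + n"]
      by (simp add: monomial_prime_def)
    then show False using m(2) n(2) by (simp add: keys_add_nat)
  qed
qed


section \<open>Quotients of monomial ideals\<close>

lemma module_self_module: "module mpoly_ring (self_module mpoly_ring)"
proof -
  interpret cring mpoly_ring by (rule cring_mpoly_ring)
  show ?thesis
  proof (rule moduleI)
    show "abelian_group (self_module mpoly_ring)"
      by (rule abelian_groupI) (auto simp: self_module_def ac_simps intro: exI[of _ "- x" for x])
  qed (simp_all add: self_module_def cring_mpoly_ring algebra_simps)
qed

lemma self_module_simps [simp]:
  "carrier (self_module mpoly_ring) = UNIV" "x \<oplus>\<^bsub>self_module mpoly_ring\<^esub> y = x + y"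
  "\<zero>\<^bsub>self_module mpoly_ring\<^esub> = 0" "r \<odot>\<^bsub>self_module mpoly_ring\<^esub> x = r * x"
  by (simp_all add: self_module_def)

lemma a_inv_self_module: "\<ominus>\<^bsub>self_module mpoly_ring\<^esub> x = - x"
proof -
  interpret module mpoly_ring "self_module mpoly_ring" by (rule module_self_module)
  show ?thesis by (rule M.minus_equality) simp_all
qed

lemma ideal_simps:
  fixes J :: "('n::finite, 'k::field) mpoly set"
  assumes "ideal J mpoly_ring"
  shows "0 \<in> J" "x \<in> J \<Longrightarrow> y \<in> J \<Longrightarrow> x + y \<in> J" "x \<in> J \<Longrightarrow> r * x \<in> J"
proof -
  have J: "additive_subgroup J mpoly_ring" using assms by (rule ideal.axioms)
  show "0 \<in> J" using additive_subgroup.zero_closed[OF J] by simp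
  show "x \<in> J \<Longrightarrow> y \<in> J \<Longrightarrow> x + y \<in> J" using additive_subgroup.a_closed[OF J, of x y] by simp
  show "x \<in> J \<Longrightarrow> r * x \<in> J" using ideal.I_l_closed[OF assms, of x r] by simp
qed

lemma ideal_uminus_closed:
  fixes J :: "('n::finite, 'k::field) mpoly set"
  assumes "ideal J mpoly_ring" "x \<in> J"
  shows "- x \<in> J"
  using ideal_simps(3)[OF assms, of "- 1"] by simp

lemma ideal_sum_closed:
  fixes J :: "('n::finite, 'k::field) mpoly set"
  assumes "ideal J mpoly_ring" "\<And>i. i \<in> Y \<Longrightarrow> h i \<in> J"
  shows "sum h Y \<in> J"
  using assms(2)
  by (induction Y rule: infinite_finite_induct) (simp_all add: ideal_simps(1,2)[OF assms(1)])

lemma submodule_ideal: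
  fixes J :: "('n::finite, 'k::field) mpoly set"
  assumes "ideal J mpoly_ring"
  shows "submodule J mpoly_ring (self_module mpoly_ring)"
proof -
  interpret module mpoly_ring "self_module mpoly_ring :: (('n, 'k) mpoly, ('n, 'k) mpoly) module" by (rule module_self_module)
  show ?thesis
    by (rule submoduleI) (simp_all add: a_inv_self_module ideal_simps[OF assms] ideal_uminus_closed[OF assms])
qed

lemma (in module) submodule_restrict:
  assumes "submodule H R M" "submodule N R M" "N \<subseteq> H"
  shows "submodule N R (M\<lparr>carrier := H\<rparr>)"
proof -
  interpret H: module R "M\<lparr>carrier := H\<rparr>" by (rule submodule.submodule_is_module[OF assms(1) module_axioms])
  show ?thesis
  proof (rule H.module_incl_imp_submodule)
    show "N \<subseteq> carrier (M\<lparr>carrier := H\<rparr>)" using assms(3) by simp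
    show "module R ((M\<lparr>carrier := H\<rparr>)\<lparr>carrier := N\<rparr>)"
      using submodule.submodule_is_module[OF assms(2) module_axioms] by simp
  qed
qed

locale ideal_pair =
  fixes I U :: "('n::finite, 'k::field) mpoly set"
  assumes I: "ideal I mpoly_ring" and U: "ideal U mpoly_ring" and IU: "I \<subseteq> U"
begin

abbreviation "MU \<equiv> (self_module mpoly_ring)\<lparr>carrier := U\<rparr>"
abbreviation "Q \<equiv> ideal_quotient_module U I"

definition cls :: "('n, 'k) mpoly \<Rightarrow> ('n, 'k) mpoly set" where
  "cls p = I +>\<^bsub>MU\<^esub> p"

sublocale MU: module mpoly_ring MU
  by (rule submodule.submodule_is_module[OF submodule_ideal[OF U] module_self_module])

lemma submodule_I: "submodule I mpoly_ring MU"
  by (rule module.submodule_restrict[OF module_self_module submodule_ideal[OF U] submodule_ideal[OF I] IU])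

sublocale Q: module mpoly_ring Q
  unfolding ideal_quotient_module_def by (rule MU.quotient_module_is_module[OF submodule_I])

lemma carrier_Q: "carrier Q = cls ` U"
  unfolding ideal_quotient_module_def cls_def by (simp add: MU.carrier_quotient_module)

lemma cls_closed: "p \<in> U \<Longrightarrow> cls p \<in> carrier Q"
  by (simp add: carrier_Q)

lemma cls_add: "p \<in> U \<Longrightarrow> q \<in> U \<Longrightarrow> cls p \<oplus>\<^bsub>Q\<^esub> cls q = cls (p + q)"
  unfolding ideal_quotient_module_def cls_def using MU.add_quotient_module[OF submodule_I] by simp

lemma cls_smult: "p \<in> U \<Longrightarrow> r \<odot>\<^bsub>Q\<^esub> cls p = cls (r * p)"
  unfolding ideal_quotient_module_def cls_def using MU.smult_quotient_module[OF submodule_I] by simp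

lemma cls_eq_zero_iff: "p \<in> U \<Longrightarrow> cls p = \<zero>\<^bsub>Q\<^esub> \<longleftrightarrow> p \<in> I"
  unfolding ideal_quotient_module_def cls_def
  using MU.coset_eq_self_iff[OF submodule_I] by (simp add: MU.zero_quotient_module)

lemma cls_eq_iff:
  assumes "p \<in> U" "q \<in> U"
  shows "cls p = cls q \<longleftrightarrow> p - q \<in> I"
proof -
  have pq: "p - q \<in> U" using ideal_simps(2)[OF U assms(1) ideal_uminus_closed[OF U assms(2)]] by simp
  have "cls p = cls (p - q) \<oplus>\<^bsub>Q\<^esub> cls q" using cls_add[OF pq assms(2)] by simp
  moreover have "cls (p - q) \<oplus>\<^bsub>Q\<^esub> cls q = cls q \<longleftrightarrow> cls (p - q) = \<zero>\<^bsub>Q\<^esub>"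
    using Q.M.add.r_cancel_one[OF cls_closed[OF assms(2)] cls_closed[OF pq]] by simp
  ultimately show ?thesis using cls_eq_zero_iff[OF pq] by simp
qed

lemma module_support_iff:
  "P \<in> module_support mpoly_ring Q \<longleftrightarrow> primeideal P mpoly_ring \<and> (\<exists>u\<in>U. \<forall>s. s \<notin> P \<longrightarrow> s * u \<notin> I)"
proof -
  have "(s \<odot>\<^bsub>Q\<^esub> cls u \<noteq> \<zero>\<^bsub>Q\<^esub>) = (s * u \<notin> I)" if "u \<in> U" for s u
    using cls_smult[OF that] cls_eq_zero_iff[OF ideal_simps(3)[OF U that]] by simp
  then have "(\<exists>x\<in>carrier Q. \<forall>s\<in>carrier mpoly_ring - P. s \<odot>\<^bsub>Q\<^esub> x \<noteq> \<zero>\<^bsub>Q\<^esub>) \<longleftrightarrow> (\<exists>u\<in>U. \<forall>s. s \<notin> P \<longrightarrow> s * u \<notin> I)"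
    unfolding carrier_Q by (simp add: Ball_def cong: bex_cong)
  then show ?thesis by (simp add: module_support_def)
qed

text \<open>Vanishing of the first local cohomology, for the cocycles that only involve the
  variables to the first power.\<close>

lemma regular_pair_lift:
  fixes w :: "'n \<Rightarrow> ('n, 'k) mpoly"
  assumes reg: "regular_sequence mpoly_ring Q (f # g # fs)"
    and f: "f = (\<Sum>i\<in>UNIV. c i * Poly_Mapping.single (var i) 1)"
    and g: "g = (\<Sum>i\<in>UNIV. d i * Poly_Mapping.single (var i) 1)"
    and w: "\<And>i. w i \<in> U"
    and comp: "\<And>i j. Poly_Mapping.single (var i) 1 * w j - Poly_Mapping.single (var j) 1 * w i \<in> I"
  shows "\<exists>v\<in>U. \<forall>i. Poly_Mapping.single (var i) 1 * v - w i \<in> I"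
proof -
  let ?x = "\<lambda>i :: 'n. Poly_Mapping.single (var i) (1::'k)"
  \<comment> \<open>If the wanted \<open>v\<close> exists, then \<open>f * v\<close> and
    \<open>g * v\<close> must be \<open>u\<close> and \<open>u'\<close> modulo \<open>I\<close>,
    because \<open>w i\<close> is then \<open>x_i v\<close>.\<close>
  define u where "u = (\<Sum>i\<in>UNIV. c i * w i)"
  define u' where "u' = (\<Sum>i\<in>UNIV. d i * w i)"
  have uU: "u \<in> U" "u' \<in> U"
    unfolding u_def u'_def by (auto intro!: ideal_sum_closed[OF U] ideal_simps(3)[OF U] w)
  \<comment> \<open>Expanding \<open>f\<close> turns \<open>f * w j\<close> into a sum of the
    \<open>c i * x_i * w j\<close>, and \<open>comp\<close> exchanges each \<open>x_i * w j\<close>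
    for \<open>x_j * w i\<close>.\<close>
  have key: "?x j * u - f * w j \<in> I" for j
  proof -
    have "?x j * u - f * w j = (\<Sum>i\<in>UNIV. c i * (?x j * w i - ?x i * w j))"
      by (simp add: u_def f sum_distrib_left sum_distrib_right sum_subtractf algebra_simps)
    then show ?thesis by (simp only:) (rule ideal_sum_closed[OF I ideal_simps(3)[OF I comp]])
  qed
  have "g * u - f * u' = (\<Sum>j\<in>UNIV. d j * (?x j * u - f * w j))"
    by (simp add: u'_def g sum_distrib_left sum_distrib_right sum_subtractf algebra_simps)
  then have gu: "g * u - f * u' \<in> I" by (simp only:) (rule ideal_sum_closed[OF I ideal_simps(3)[OF I key]])
  have "cls (g * u) = cls (f * u')"
    using cls_eq_iff[OF ideal_simps(3)[OF U uU(1)] ideal_simps(3)[OF U uU(2)]] gu by blast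
  then have "g \<odot>\<^bsub>Q\<^esub> cls u = f \<odot>\<^bsub>Q\<^esub> cls u'" by (simp add: cls_smult uU)
  then obtain z where "z \<in> carrier Q" "cls u = f \<odot>\<^bsub>Q\<^esub> z"
    using Q.regular_sequence_pair(2)[OF reg cls_closed[OF uU(1)] cls_closed[OF uU(2)]] by blast
  then obtain v where v: "v \<in> U" "cls u = f \<odot>\<^bsub>Q\<^esub> cls v" by (auto simp: carrier_Q)
  then have uv: "u - f * v \<in> I" using cls_smult cls_eq_iff[OF uU(1) ideal_simps(3)[OF U v(1)]] by simp
  \<comment> \<open>Modulo \<open>I\<close>, both \<open>f * (x_j v)\<close> and
    \<open>f * w j\<close> equal \<open>x_j u\<close>; regularity of \<open>f\<close> cancels
    it.\<close>
  have "?x j * v - w j \<in> I" for j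
  proof -
    have W: "?x j * v - w j \<in> U"
      using ideal_simps(2)[OF U ideal_simps(3)[OF U v(1)] ideal_uminus_closed[OF U w]] by simp
    have "f * (?x j * v - w j) = (?x j * u - f * w j) + - ?x j * (u - f * v)" by (simp add: algebra_simps)
    then have "f * (?x j * v - w j) \<in> I" using ideal_simps(2)[OF I key ideal_simps(3)[OF I uv]] by metis
    then have "f \<odot>\<^bsub>Q\<^esub> cls (?x j * v - w j) = \<zero>\<^bsub>Q\<^esub>"
      using cls_smult[OF W] cls_eq_zero_iff[OF ideal_simps(3)[OF U W]] by simp
    then have "cls (?x j * v - w j) = \<zero>\<^bsub>Q\<^esub>" by (rule Q.regular_sequence_pair(1)[OF reg cls_closed[OF W]])
    then show ?thesis using cls_eq_zero_iff[OF W] by blast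
  qed
  then show ?thesis using v(1) by blast
qed

end

lemma variables_idealE:
  fixes f :: "('n::finite, 'k::field) mpoly"
  assumes "f \<in> variables_ideal"
  obtains c where "f = (\<Sum>i\<in>UNIV. c i * Poly_Mapping.single (var i) 1)"
proof -
  let ?x = "\<lambda>i :: 'n. Poly_Mapping.single (var i) (1::'k)"
  let ?J = "range (\<lambda>c. \<Sum>i\<in>UNIV. c i * ?x i)"
  interpret cring "mpoly_ring :: ('n, 'k) mpoly ring" by (rule cring_mpoly_ring)
  have mem: "q \<in> ?J" if "q = (\<Sum>i\<in>UNIV. c i * ?x i)" for q c using that by (rule image_eqI[where x = c]) simp
  have "variables_ideal \<subseteq> ?J"
    unfolding variables_ideal_def
  proof (rule genideal_minimal)
    show "ideal ?J mpoly_ring"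
    proof (rule idealI)
      show "ring (mpoly_ring :: ('n, 'k) mpoly ring)" by (rule ring_axioms)
      show "subgroup ?J (add_monoid mpoly_ring)"
      proof (rule add.subgroupI)
        fix a assume "a \<in> ?J"
        then obtain c where "a = (\<Sum>i\<in>UNIV. c i * ?x i)" by blast
        then have "\<ominus>\<^bsub>mpoly_ring\<^esub> a = (\<Sum>i\<in>UNIV. (- c i) * ?x i)" by (simp add: a_inv_mpoly_ring sum_negf)
        then show "\<ominus>\<^bsub>mpoly_ring\<^esub> a \<in> ?J" by (rule mem)
        fix b assume "b \<in> ?J"
        then obtain d where "b = (\<Sum>i\<in>UNIV. d i * ?x i)" by blast
        then have "a \<oplus>\<^bsub>mpoly_ring\<^esub> b = (\<Sum>i\<in>UNIV. (c i + d i) * ?x i)"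
          using \<open>a = _\<close> by (simp add: sum.distrib algebra_simps)
        then show "a \<oplus>\<^bsub>mpoly_ring\<^esub> b \<in> ?J" by (rule mem)
      qed auto
    next
      fix a y assume "a \<in> ?J"
      then obtain c where "a = (\<Sum>i\<in>UNIV. c i * ?x i)" by blast
      then have "y * a = (\<Sum>i\<in>UNIV. (y * c i) * ?x i)" by (simp add: sum_distrib_left mult.assoc)
      then have "y * a \<in> ?J" by (rule mem)
      then show "y \<otimes>\<^bsub>mpoly_ring\<^esub> a \<in> ?J" "a \<otimes>\<^bsub>mpoly_ring\<^esub> y \<in> ?J" by (simp_all add: mult.commute)
    qed
    show "range (\<lambda>i. Poly_Mapping.single (Poly_Mapping.single i 1) 1) \<subseteq> ?J"
    proof
      fix p :: "('n, 'k) mpoly" assume "p \<in> range (\<lambda>i. Poly_Mapping.single (Poly_Mapping.single i 1) 1)"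
      then obtain i where "p = ?x i" by (auto simp: var_def)
      also have "\<dots> = (\<Sum>j\<in>UNIV. (if j = i then 1 else 0) * ?x j)" by (simp add: if_distrib[of "\<lambda>z. z * _"] cong: if_cong)
      finally show "p \<in> ?J" by (rule mem)
    qed
  qed
  then show ?thesis using assms that by blast
qed

lemma lookup_monomial_mult:
  fixes p :: "('n, 'k::field) mpoly"
  shows "Poly_Mapping.lookup (Poly_Mapping.single a 1 * p) (a + m) = Poly_Mapping.lookup p m"
proof -
  define p' where "p' = p - Poly_Mapping.single m (Poly_Mapping.lookup p m)"
  have p': "m \<notin> Poly_Mapping.keys p'" by (simp add: p'_def in_keys_iff lookup_minus)
  have "a + m \<notin> Poly_Mapping.keys (Poly_Mapping.single a 1 * p')"
  proof
    assume "a + m \<in> Poly_Mapping.keys (Poly_Mapping.single a 1 * p')"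
    then obtain b where "b \<in> Poly_Mapping.keys p'" "a + m = a + b"
      using keys_mult[of "Poly_Mapping.single a (1::'k)" p'] by auto
    then show False using p' by simp
  qed
  moreover have "Poly_Mapping.single a 1 * p = Poly_Mapping.single a 1 * p' + Poly_Mapping.single (a + m) (Poly_Mapping.lookup p m)"
    using mult_single[of a 1 m "Poly_Mapping.lookup p m"] by (simp add: p'_def algebra_simps)
  ultimately show ?thesis by (simp add: lookup_add in_keys_iff)
qed

lemma keys_monomial_mult:
  fixes p :: "('n, 'k::field) mpoly"
  shows "Poly_Mapping.keys (Poly_Mapping.single a 1 * p) = (\<lambda>m. a + m) ` Poly_Mapping.keys p"
proof
  show "Poly_Mapping.keys (Poly_Mapping.single a 1 * p) \<subseteq> (\<lambda>m. a + m) ` Poly_Mapping.keys p"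
    using keys_mult[of "Poly_Mapping.single a (1::'k)" p] by auto
  show "(\<lambda>m. a + m) ` Poly_Mapping.keys p \<subseteq> Poly_Mapping.keys (Poly_Mapping.single a 1 * p)"
    by (auto simp: in_keys_iff lookup_monomial_mult)
qed


section \<open>Exponents of a two-dimensional Cohen-Macaulay quotient\<close>

locale monomial_pair =
  fixes A B :: "('n::finite \<Rightarrow>\<^sub>0 nat) set" and I U :: "('n, 'k::field) mpoly set"
  assumes I_def: "I = monomial_span A" and U_def: "U = monomial_span B"
    and A_up: "m \<in> A \<Longrightarrow> m + t \<in> A" and B_up: "m \<in> B \<Longrightarrow> m + t \<in> B"
    and AB: "A \<subseteq> B"
    and A_keys: "m \<in> A \<Longrightarrow> Poly_Mapping.keys m \<subseteq> Poly_Mapping.keys m' \<Longrightarrow> m' \<in> A"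
begin

sublocale ideal_pair I U
proof (rule ideal_pair.intro)
  show "ideal I mpoly_ring" unfolding I_def by (rule ideal_monomial_span) (rule A_up)
  show "ideal U mpoly_ring" unfolding U_def by (rule ideal_monomial_span) (rule B_up)
  show "I \<subseteq> U" unfolding I_def U_def by (rule monomial_span_mono[OF AB])
qed

lemma lookup_zero_if_mem_I: "p \<in> I \<Longrightarrow> m \<notin> A \<Longrightarrow> Poly_Mapping.lookup p m = 0"
  using monomial_spanD[of p A m] by (auto simp: I_def in_keys_iff)

text \<open>The witness is the monomial of \<open>m\<close>. An \<open>s\<close> outside the prime
  has a term supported inside \<open>G\<close>; multiplying by that term does not enlarge the
  support of \<open>m\<close>, so the product has a term outside \<open>A\<close>.\<close>

lemma monomial_prime_in_support:
  assumes m: "m \<in> B" "m \<notin> A" and G: "G \<subseteq> Poly_Mapping.keys m"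
  shows "monomial_prime G \<in> module_support mpoly_ring Q"
  unfolding module_support_iff
proof (intro conjI bexI allI impI)
  show "primeideal (monomial_prime G) mpoly_ring" by (rule primeideal_monomial_prime)
  show "Poly_Mapping.single m 1 \<in> U" using m by (simp add: U_def)
  fix s :: "('n, 'k) mpoly" assume "s \<notin> monomial_prime G"
  then obtain t where t: "t \<in> Poly_Mapping.keys s" "Poly_Mapping.keys t \<subseteq> G"
    by (auto simp: monomial_prime_def monomial_span_def)
  have "Poly_Mapping.keys (m + t) \<subseteq> Poly_Mapping.keys m" using t(2) G by (auto simp: keys_add_nat)
  then have "m + t \<notin> A" using A_keys m(2) by blast
  moreover have "m + t \<in> Poly_Mapping.keys (s * Poly_Mapping.single m 1)"
    using t(1) by (simp add: mult.commute[of s] keys_monomial_mult)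
  ultimately show "s * Poly_Mapping.single m 1 \<notin> I" using monomial_spanD unfolding I_def by blast
qed

text \<open>A monomial outside \<open>I\<close> with three variables \<open>i, j, k\<close> in its
  support would give the chain of primes for \<open>{i, j, k}\<close>, \<open>{i, j}\<close>,
  \<open>{i}\<close>, \<open>{}\<close>, which has length three.\<close>

lemma dim_two_imp_card_keys:
  assumes dim: "module_dim mpoly_ring Q = 2" and m: "m \<in> B" "3 \<le> card (Poly_Mapping.keys m)"
  shows "m \<in> A"
proof (rule ccontr)
  assume mA: "m \<notin> A"
  obtain T where T: "T \<subseteq> Poly_Mapping.keys m" "card T = 3"
    using m(2) by (meson obtain_subset_with_card_n)
  obtain i j k where ijk: "T = {i, j, k}" "i \<noteq> j" "i \<noteq> k" "j \<noteq> k"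
    using T(2) unfolding card_3_iff by blast
  define F where "F n = (if n = 0 then {i, j, k} else if n = 1 then {i, j} else if n = 2 then {i} else {})" for n :: nat
  define C where "C n = (monomial_prime (F n) :: ('n, 'k) mpoly set)" for n
  have sub: "F n \<subseteq> Poly_Mapping.keys m" for n using T(1) ijk(1) by (auto simp: F_def)
  have strict: "F (Suc n) \<subset> F n" if "n < 3" for n
  proof -
    have "n = 0 \<or> n = 1 \<or> n = 2" using that by linarith
    then show ?thesis using ijk by (auto simp: F_def)
  qed
  have "C n \<in> module_support mpoly_ring Q" for n
    unfolding C_def by (rule monomial_prime_in_support[OF m(1) mA sub])
  moreover have "C n \<subset> C (Suc n)" if "n < 3" for n
    using strict[OF that] unfolding C_def less_le_not_le monomial_prime_subset_iff by auto
  ultimately have "enat 3 \<in> {enat k | k. \<exists>C. (\<forall>i\<le>k. C i \<in> module_support mpoly_ring Q) \<and> (\<forall>i<k. C i \<subset> C (Suc i))}"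
    by blast
  then have "enat 3 \<le> module_dim mpoly_ring Q" unfolding module_dim_def by (rule Sup_upper)
  then show False using dim by (simp add: numeral_eq_enat)
qed

text \<open>The grade is a supremum equal to two, so some regular sequence in the ideal of the
  variables has at least two members; the first two suffice.\<close>

lemma cocycle_lift:
  fixes w :: "'n \<Rightarrow> ('n, 'k) mpoly"
  assumes cm: "cohen_macaulay Q" and dim: "module_dim mpoly_ring Q = 2"
    and w: "\<And>i. w i \<in> U"
    and comp: "\<And>i j. Poly_Mapping.single (var i) 1 * w j - Poly_Mapping.single (var j) 1 * w i \<in> I"
  obtains v where "v \<in> U" "\<And>i. Poly_Mapping.single (var i) 1 * v - w i \<in> I"
proof -
  have "1 < module_grade mpoly_ring variables_ideal Q"
    using cm dim by (simp add: cohen_macaulay_def numeral_eq_enat one_enat_def)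
  then obtain fs where fs: "set fs \<subseteq> variables_ideal" "regular_sequence mpoly_ring Q fs" "1 < enat (length fs)"
    unfolding module_grade_def less_Sup_iff by blast
  then have "1 < length fs" by (simp add: one_enat_def)
  then obtain f g fs' where fg: "fs = f # g # fs'"
    by (metis One_nat_def length_0_conv length_Suc_conv less_irrefl less_nat_zero_code list.exhaust)
  obtain c where c: "f = (\<Sum>i\<in>UNIV. c i * Poly_Mapping.single (var i) 1)"
    using variables_idealE[of f] fs(1) fg by auto
  obtain d where d: "g = (\<Sum>i\<in>UNIV. d i * Poly_Mapping.single (var i) 1)"
    using variables_idealE[of g] fs(1) fg by auto
  show ?thesis
    using regular_pair_lift[OF fs(2)[unfolded fg] c d w comp] that by blast
qed

lemma depth_two_exponents:
  assumes cm: "cohen_macaulay Q" and dim: "module_dim mpoly_ring Q = 2"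
  shows "depth_two_exponents A B"
proof
  show "A \<subseteq> B" by (rule AB)
  show "m' \<in> A" if "m \<in> A" "Poly_Mapping.keys m \<subseteq> Poly_Mapping.keys m'" for m m' using A_keys that .
  show "m + t \<in> B" if "m \<in> B" for m t using B_up that .
  show "m \<in> A" if "m \<in> B" "3 \<le> card (Poly_Mapping.keys m)" for m using dim_two_imp_card_keys[OF dim] that .
next
  fix T :: "'n set" and m k
  assume T: "\<And>k. k \<in> T \<Longrightarrow> m + var k \<in> B" and TA: "\<And>k l. k \<in> T \<Longrightarrow> l \<notin> T \<Longrightarrow> m + var k + var l \<in> A"
    and k: "k \<in> T" "m + var k \<notin> A"
  \<comment> \<open>On \<open>T\<close> this family imitates multiplication by the monomial of
    \<open>m\<close>, which is not yet known to be in \<open>U\<close>; off \<open>T\<close> it is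
    zero. The mixed products lie in \<open>I\<close> by \<open>TA\<close>, so it is
    compatible.\<close>
  define w where "w i = (if i \<in> T then Poly_Mapping.single (m + var i) (1::'k) else 0)" for i
  have wU: "w i \<in> U" for i using T by (simp add: w_def U_def)
  have comp: "Poly_Mapping.single (var i) 1 * w j - Poly_Mapping.single (var j) 1 * w i \<in> I" for i j
  proof -
    have "Poly_Mapping.single (m + var i + var j) (1::'k) \<in> I" if "i \<in> T" "j \<notin> T" for i j
      using TA[OF that] by (simp add: I_def)
    then have x: "Poly_Mapping.single (var j) 1 * w i \<in> I" if "i \<in> T" "j \<notin> T" for i j
      using that by (simp add: w_def mult_single ac_simps)
    show ?thesis
      using x[of i j] x[of j i] ideal_uminus_closed[OF I x[of i j]] ideal_simps(1)[OF I]
      by (cases "i \<in> T"; cases "j \<in> T") (simp_all add: w_def mult_single ac_simps)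
  qed
  obtain v where v: "v \<in> U" "\<And>i. Poly_Mapping.single (var i) 1 * v - w i \<in> I"
    using cocycle_lift[OF cm dim wU comp] by blast
  \<comment> \<open>Since \<open>m + var k\<close> is not in \<open>A\<close>, coefficients there
    can be compared modulo \<open>I\<close>. This forces \<open>v\<close> to contain the monomial of
    \<open>m\<close>, with coefficient \<open>1\<close>.\<close>
  have "Poly_Mapping.lookup (Poly_Mapping.single (var k) 1 * v - w k) (var k + m) = 0"
    by (rule lookup_zero_if_mem_I[OF v(2)]) (use k(2) in \<open>simp add: add.commute\<close>)
  then have "Poly_Mapping.lookup v m = 1"
    using k(1) by (simp add: lookup_minus lookup_monomial_mult w_def add.commute[of m])
  then have m: "m \<in> Poly_Mapping.keys v" by (simp add: in_keys_iff)
  show "m \<in> B \<and> (\<forall>l. l \<notin> T \<longrightarrow> m + var l \<in> A)"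
  proof (intro conjI allI impI)
    show "m \<in> B" using monomial_spanD m v(1) unfolding U_def by blast
    fix l assume "l \<notin> T"
    then have "Poly_Mapping.single (var l) 1 * v \<in> monomial_span A" using v(2)[of l] by (simp add: w_def I_def)
    moreover have "m + var l \<in> Poly_Mapping.keys (Poly_Mapping.single (var l) 1 * v)"
      using m by (simp add: keys_monomial_mult add.commute[of m])
    ultimately show "m + var l \<in> A" by (rule monomial_spanD)
  qed
next
  fix m i assume m: "m \<in> B - A"
  show "\<exists>k. k \<noteq> i \<and> m + var k \<notin> A"
  proof (rule ccontr)
    assume "\<not> ?thesis"
    then have "\<And>k. k \<noteq> i \<Longrightarrow> m + var k \<in> A" by blast
    with m show False
    \<comment> \<open>An infinite descent: such a monomial is divisible by \<open>x\<^sub>i\<close> within \<open>U\<close>, with a quotient of the same kind.\<close>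
    proof (induction "Poly_Mapping.lookup m i" arbitrary: m rule: less_induct)
      case less
      \<comment> \<open>This family stands for the fraction \<open>x^m / x_i\<close>; it is
        compatible because every other variable sends \<open>x^m\<close> into \<open>I\<close>. The
        lift \<open>v\<close> realizes the fraction by a monomial of \<open>U\<close>.\<close>
      define w where "w j = (if j = i then Poly_Mapping.single m (1::'k) else 0)" for j
      have wU: "w j \<in> U" for j using less.prems(1) by (simp add: w_def U_def)
      have comp: "Poly_Mapping.single (var l) 1 * w j - Poly_Mapping.single (var j) 1 * w l \<in> I" for l j
      proof -
        have x: "Poly_Mapping.single (var l) (1::'k) * Poly_Mapping.single m 1 \<in> I" if "l \<noteq> i" for l
          using less.prems(2)[OF that] by (simp add: I_def mult_single add.commute)
        show ?thesis
          using x[of l] x[of j] ideal_uminus_closed[OF I x[of j]] ideal_simps(1)[OF I]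
          by (cases "l = i"; cases "j = i") (simp_all add: w_def)
      qed
      obtain v where v: "v \<in> U" "\<And>j. Poly_Mapping.single (var j) 1 * v - w j \<in> I"
        using cocycle_lift[OF cm dim wU comp] by blast
      have "Poly_Mapping.lookup (Poly_Mapping.single (var i) 1 * v - w i) m = 0"
        by (rule lookup_zero_if_mem_I[OF v(2)]) (use less.prems(1) in simp)
      then have "m \<in> Poly_Mapping.keys (Poly_Mapping.single (var i) 1 * v)"
        by (simp add: lookup_minus w_def in_keys_iff)
      then obtain n where n: "n \<in> Poly_Mapping.keys v" "m = var i + n" by (auto simp: keys_monomial_mult)
      show False
      proof (rule less.hyps)
        show "Poly_Mapping.lookup n i < Poly_Mapping.lookup m i" by (simp add: n(2) lookup_add lookup_var)
        have "n \<in> B" using monomial_spanD[OF _ n(1)] v(1) unfolding U_def by blast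
        moreover have "n \<notin> A"
        proof
          assume "n \<in> A"
          then have "n + var i \<in> A" by (rule A_up)
          then show False using less.prems(1) n(2) by (simp add: add.commute)
        qed
        ultimately show "n \<in> B - A" by simp
        fix k assume "k \<noteq> i"
        then have "Poly_Mapping.single (var k) 1 * v \<in> monomial_span A" using v(2)[of k] by (simp add: w_def I_def)
        moreover have "n + var k \<in> Poly_Mapping.keys (Poly_Mapping.single (var k) 1 * v)"
          using n(1) by (simp add: keys_monomial_mult add.commute[of n])
        ultimately show "n + var k \<in> A" by (rule monomial_spanD)
      qed
    qed
  qed
qed

end

section \<open>Support and minimal primes of the quotient\<close>

locale depth_two_pair = monomial_pair + depth_two_exponents A B
begin

text \<open>Otherwise each edge \<open>e\<close> has a variable outside \<open>e\<close> that is not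
  in \<open>P\<close>. The product of these variables over all edges is a monomial outside
  \<open>P\<close> that lies over no edge, so it sends all of \<open>U\<close> into
  \<open>I\<close>.\<close>

lemma edge_prime_below_support:
  assumes "P \<in> module_support mpoly_ring Q"
  shows "\<exists>e\<in>edges. monomial_prime e \<subseteq> P"
proof (rule ccontr)
  assume neg: "\<not> ?thesis"
  obtain u where P: "primeideal P mpoly_ring" and u: "u \<in> U" "\<And>s. s \<notin> P \<Longrightarrow> s * u \<notin> I"
    using assms unfolding module_support_iff by blast
  have Pi: "ideal P mpoly_ring" using P by (simp add: primeideal.axioms)
  have out: "\<exists>k. k \<notin> e \<and> Poly_Mapping.single (var k) 1 \<notin> P" if e: "e \<in> edges" for e
  proof (rule ccontr)
    assume "\<not> ?thesis"
    then have x: "\<And>k. k \<notin> e \<Longrightarrow> Poly_Mapping.single (var k) 1 \<in> P" by blast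
    have "monomial_prime e \<subseteq> P"
    proof
      fix p :: "('a, 'b) mpoly" assume p: "p \<in> monomial_prime e"
      have term_in: "Poly_Mapping.single m (Poly_Mapping.lookup p m) \<in> P" if "m \<in> Poly_Mapping.keys p" for m
      proof -
        have "\<not> Poly_Mapping.keys m \<subseteq> e" using monomial_spanD[OF _ that] p unfolding monomial_prime_def by blast
        then obtain k where k: "k \<in> Poly_Mapping.keys m" "k \<notin> e" by blast
        have m: "m = var k + (m - var k)"
          by (rule exponent_eq_add_diff) (use k(1) in \<open>auto simp: lookup_var in_keys_iff Suc_le_eq\<close>)
        have "Poly_Mapping.single (m - var k) (Poly_Mapping.lookup p m) * Poly_Mapping.single (var k) 1 \<in> P"
          by (rule ideal_simps(3)[OF Pi x[OF k(2)]])
        then show ?thesis using m by (simp add: mult_single add.commute)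
      qed
      then show "p \<in> P" by (subst poly_mapping_eq_sum_single) (rule ideal_sum_closed[OF Pi])
    qed
    then show False using neg e by blast
  qed
  have "\<exists>a. Poly_Mapping.single a 1 \<notin> P \<and> (\<forall>e\<in>E. \<not> Poly_Mapping.keys a \<subseteq> e)" if "finite E" "E \<subseteq> edges" for E
    using that
  proof (induction E rule: finite_induct)
    case empty
    have "1 \<notin> P"
    proof
      assume "1 \<in> P"
      then have "x \<in> P" for x using ideal_simps(3)[OF Pi, of 1 x] by simp
      then show False using primeideal.I_notcarr[OF P] by auto
    qed
    then show ?case by (intro exI[of _ 0]) simp
  next
    case (insert e E)
    then obtain a where a: "Poly_Mapping.single a 1 \<notin> P" "\<forall>e\<in>E. \<not> Poly_Mapping.keys a \<subseteq> e" by auto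
    obtain k where k: "k \<notin> e" "Poly_Mapping.single (var k) 1 \<notin> P" using out insert.prems by auto
    have "Poly_Mapping.single a 1 * Poly_Mapping.single (var k) 1 \<notin> P"
      using primeideal.I_prime[OF P, of "Poly_Mapping.single a 1" "Poly_Mapping.single (var k) 1"] a(1) k(2) by auto
    then have "Poly_Mapping.single (a + var k) 1 \<notin> P" by (simp add: mult_single)
    then show ?case using a(2) k(1) by (intro exI[of _ "a + var k"]) (auto simp: keys_add_nat)
  qed
  from this[of edges] obtain a where a: "Poly_Mapping.single a 1 \<notin> P" "\<forall>e\<in>edges. \<not> Poly_Mapping.keys a \<subseteq> e"
    by auto
  have "a + m \<in> A" if "m \<in> Poly_Mapping.keys u" for m
  proof (rule ccontr)
    assume "a + m \<notin> A"
    moreover have "m \<in> B" using monomial_spanD[OF _ that] u(1) unfolding U_def by blast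
    then have "a + m \<in> B" using B_up[of m a] by (simp add: add.commute)
    ultimately obtain e where "e \<in> edges" "Poly_Mapping.keys (a + m) \<subseteq> e" using keys_subset_edge by blast
    then show False using a(2) by (simp add: keys_add_nat)
  qed
  then have "Poly_Mapping.single a 1 * u \<in> I"
    unfolding I_def monomial_span_def by (auto simp: keys_monomial_mult)
  then show False using u(2)[OF a(1)] by simp
qed

text \<open>The edge primes belong to the support, and each prime of the support contains one of
  them. They are pairwise incomparable because all edges have two elements.\<close>

lemma min_primes_eq: "min_primes mpoly_ring Q = monomial_prime ` edges"
proof -
  have supp: "monomial_prime e \<in> module_support mpoly_ring Q" if e: "e \<in> edges" for e
  proof -
    obtain m where "m \<in> B - A" "Poly_Mapping.keys m = e" using e unfolding edges_def by blast
    then show ?thesis using monomial_prime_in_support[of m e] by simp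
  qed
  have anti: "e = e'" if "e \<in> edges" "e' \<in> edges" "e \<subseteq> e'" for e e'
    using that card_subset_eq[of e' e] by (simp add: edges_def)
  show ?thesis
  proof (intro equalityI subsetI)
    fix P assume "P \<in> min_primes mpoly_ring Q"
    then have P: "P \<in> module_support mpoly_ring Q" "\<And>J. J \<in> module_support mpoly_ring Q \<Longrightarrow> J \<subseteq> P \<Longrightarrow> J = P"
      by (auto simp: min_primes_def)
    obtain e where e: "e \<in> edges" "monomial_prime e \<subseteq> P" using edge_prime_below_support[OF P(1)] by blast
    have "monomial_prime e = P" by (rule P(2)[OF supp[OF e(1)] e(2)])
    then show "P \<in> monomial_prime ` edges" using e(1) by blast
  next
    fix P :: "('a, 'b) mpoly set" assume "P \<in> monomial_prime ` edges"
    then obtain e where e: "e \<in> edges" "P = monomial_prime e" by blast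
    have "J = P" if J: "J \<in> module_support mpoly_ring Q" "J \<subseteq> P" for J
    proof -
      obtain e' where e': "e' \<in> edges" "monomial_prime e' \<subseteq> J" using edge_prime_below_support[OF J(1)] by blast
      have "monomial_prime e' \<subseteq> (monomial_prime e :: ('a, 'b) mpoly set)" using e'(2) J(2) e(2) by simp
      then have "e = e'" using anti e(1) e'(1) by (simp only: monomial_prime_subset_iff)
      then show ?thesis using e'(2) J(2) e(2) by simp
    qed
    then show "P \<in> min_primes mpoly_ring Q" using supp[OF e(1)] e(2) by (simp add: min_primes_def)
  qed
qed

end


section \<open>From chains of exponent sets to prime filtrations\<close>

context monomial_pair
begin

abbreviation "gr \<equiv> ideal_quotient_grading U I"

definition cls_span :: "('n \<Rightarrow>\<^sub>0 nat) set \<Rightarrow> ('n, 'k) mpoly set set" where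
  "cls_span C = cls ` monomial_span C"

lemma gr_eq: "gr b = cls ` (mpoly_grading b \<inter> U)"
  by (simp add: ideal_quotient_grading_def quotient_grading_def restrict_grading_def cls_def)

lemma span_subset_U: "C \<subseteq> B \<Longrightarrow> monomial_span C \<subseteq> U"
  unfolding U_def by (rule monomial_span_mono)

lemma I_subset_span: "A \<subseteq> C \<Longrightarrow> I \<subseteq> monomial_span C"
  unfolding I_def by (rule monomial_span_mono)

text \<open>As \<open>A \<subseteq> C\<close>, the span contains \<open>I\<close>, so membership
  does not depend on the representative.\<close>

lemma cls_mem_cls_span_iff:
  assumes "A \<subseteq> C" "C \<subseteq> B" "p \<in> U"
  shows "cls p \<in> cls_span C \<longleftrightarrow> p \<in> monomial_span C"
proof
  assume "cls p \<in> cls_span C"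
  then obtain q where q: "q \<in> monomial_span C" "cls p = cls q" by (auto simp: cls_span_def)
  have "p - q \<in> I" using q cls_eq_iff[OF assms(3)] span_subset_U[OF assms(2)] by blast
  then have "p - q \<in> monomial_span C" using I_subset_span[OF assms(1)] by blast
  then show "p \<in> monomial_span C" using add_mem_monomial_span[OF _ q(1), of "p - q"] by simp
qed (simp add: cls_span_def)

lemma cls_minus: "p \<in> U \<Longrightarrow> \<ominus>\<^bsub>Q\<^esub> cls p = cls (- p)"
proof (rule Q.M.minus_equality)
  assume p: "p \<in> U"
  have "cls 0 = \<zero>\<^bsub>Q\<^esub>" using cls_eq_zero_iff[OF ideal_simps(1)[OF U]] ideal_simps(1)[OF I] by blast
  then show "cls (- p) \<oplus>\<^bsub>Q\<^esub> cls p = \<zero>\<^bsub>Q\<^esub>" using cls_add[OF ideal_uminus_closed[OF U p] p] by simp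
qed (simp_all add: cls_closed ideal_uminus_closed[OF U])

lemma cls_zero: "cls 0 = \<zero>\<^bsub>Q\<^esub>"
  using cls_eq_zero_iff[OF ideal_simps(1)[OF U]] ideal_simps(1)[OF I] by blast

lemma submodule_cls_span:
  assumes "C \<subseteq> B" and up: "\<And>m t. m \<in> C \<Longrightarrow> m + t \<in> C"
  shows "submodule (cls_span C) mpoly_ring Q"
proof (rule Q.submoduleI)
  have J: "ideal (monomial_span C :: ('n, 'k) mpoly set) mpoly_ring" by (rule ideal_monomial_span) (rule up)
  have CU: "\<And>p. p \<in> monomial_span C \<Longrightarrow> p \<in> U" using span_subset_U[OF assms(1)] by blast
  have clsI: "\<And>p. p \<in> monomial_span C \<Longrightarrow> cls p \<in> cls_span C" by (simp add: cls_span_def)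
  show "cls_span C \<subseteq> carrier Q" using CU by (auto simp: cls_span_def carrier_Q)
  show "\<zero>\<^bsub>Q\<^esub> \<in> cls_span C" using clsI[OF ideal_simps(1)[OF J]] cls_zero by simp
  show "\<ominus>\<^bsub>Q\<^esub> x \<in> cls_span C" if x: "x \<in> cls_span C" for x
  proof -
    obtain p where p: "p \<in> monomial_span C" "x = cls p" using x by (auto simp: cls_span_def)
    show ?thesis using clsI[OF ideal_uminus_closed[OF J p(1)]] cls_minus[OF CU[OF p(1)]] p(2) by simp
  qed
  show "x \<oplus>\<^bsub>Q\<^esub> y \<in> cls_span C" if xy: "x \<in> cls_span C" "y \<in> cls_span C" for x y
  proof -
    obtain p q where p: "p \<in> monomial_span C" "x = cls p" and q: "q \<in> monomial_span C" "y = cls q"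
      using xy by (auto simp: cls_span_def)
    show ?thesis using clsI[OF ideal_simps(2)[OF J p(1) q(1)]] cls_add[OF CU[OF p(1)] CU[OF q(1)]] p(2) q(2) by simp
  qed
  show "r \<odot>\<^bsub>Q\<^esub> x \<in> cls_span C" if x: "x \<in> cls_span C" for r x
  proof -
    obtain p where p: "p \<in> monomial_span C" "x = cls p" using x by (auto simp: cls_span_def)
    show ?thesis using clsI[OF ideal_simps(3)[OF J p(1)]] cls_smult[OF CU[OF p(1)]] p(2) by simp
  qed
qed

lemma finsum_cls:
  assumes "finite Y" "\<And>b. b \<in> Y \<Longrightarrow> f b \<in> U"
  shows "(\<Oplus>\<^bsub>Q\<^esub>b\<in>Y. cls (f b)) = cls (\<Sum>b\<in>Y. f b)"
  using assms
proof (induction Y rule: finite_induct)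
  case empty
  show ?case using cls_zero by simp
next
  case (insert y Y)
  have s: "sum f Y \<in> U" by (rule ideal_sum_closed[OF U]) (simp add: insert.prems)
  have "(\<Oplus>\<^bsub>Q\<^esub>b\<in>insert y Y. cls (f b)) = cls (f y) \<oplus>\<^bsub>Q\<^esub> (\<Oplus>\<^bsub>Q\<^esub>b\<in>Y. cls (f b))"
    by (rule Q.M.finsum_insert) (use insert in \<open>auto intro: cls_closed\<close>)
  then show ?case using insert s by (simp add: cls_add)
qed

text \<open>Distinct exponents have distinct degrees, so the homogeneous components of a polynomial
  are its single terms, and these stay in the span.\<close>

lemma multigraded_submodule_cls_span:
  assumes CB: "C \<subseteq> B" and up: "\<And>m t. m \<in> C \<Longrightarrow> m + t \<in> C"
  shows "multigraded_submodule Q gr (cls_span C)"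
  unfolding multigraded_submodule_def
proof (intro conjI ballI)
  show "submodule (cls_span C) mpoly_ring Q" by (rule submodule_cls_span[OF assms])
  fix x assume "x \<in> cls_span C"
  then obtain p where p: "p \<in> monomial_span C" "x = cls p" by (auto simp: cls_span_def)
  define dg where "dg m = (\<lambda>i. int (Poly_Mapping.lookup m i))" for m :: "'n \<Rightarrow>\<^sub>0 nat"
  have inj: "inj dg"
    by (rule injI, rule poly_mapping_eqI) (simp add: dg_def fun_eq_iff)
  define f where "f b = Poly_Mapping.single (inv_into UNIV dg b) (Poly_Mapping.lookup p (inv_into UNIV dg b))" for b
  have f: "f (dg m) = Poly_Mapping.single m (Poly_Mapping.lookup p m)" for m
    by (simp add: f_def inv_into_f_f[OF inj])
  have fC: "f b \<in> monomial_span C \<inter> mpoly_grading b" if b: "b \<in> dg ` Poly_Mapping.keys p" for b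
  proof -
    obtain m where m: "m \<in> Poly_Mapping.keys p" "b = dg m" using b by blast
    have "m \<in> C" by (rule monomial_spanD[OF p(1) m(1)])
    then show ?thesis unfolding m(2) f by (simp add: monomial_span_def mpoly_grading_def dg_def)
  qed
  have fU: "f b \<in> U" if "b \<in> dg ` Poly_Mapping.keys p" for b
    using fC[OF that] span_subset_U[OF CB] by blast
  have "p = (\<Sum>b\<in>dg ` Poly_Mapping.keys p. f b)"
    by (subst poly_mapping_eq_sum_single) (simp add: sum.reindex[OF inj_on_subset[OF inj]] f)
  then have "x = (\<Oplus>\<^bsub>Q\<^esub>b\<in>dg ` Poly_Mapping.keys p. cls (f b))"
    using finsum_cls[of "dg ` Poly_Mapping.keys p" f] fU p(2) by simp
  moreover have "cls (f b) \<in> cls_span C \<inter> gr b" if "b \<in> dg ` Poly_Mapping.keys p" for b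
    using fC[OF that] fU[OF that] by (simp add: cls_span_def gr_eq)
  ultimately show "\<exists>Y h. finite Y \<and> (\<forall>b\<in>Y. h b \<in> cls_span C \<inter> gr b) \<and> x = (\<Oplus>\<^bsub>Q\<^esub>b\<in>Y. h b)"
    by (intro exI[of _ "dg ` Poly_Mapping.keys p"] exI[of _ "\<lambda>b. cls (f b)"]) simp
qed

text \<open>A term of \<open>p\<close> with exponent outside \<open>C\<close> has exponent
  \<open>a + t\<close>, so the monomial of \<open>a\<close> can be factored out of all these terms.
  The clause about exponents lets the degree of \<open>q\<close> be read off from that of
  \<open>p\<close>.\<close>

lemma split_off_translate:
  fixes p :: "('n, 'k) mpoly"
  assumes p: "p \<in> monomial_span D" and D: "D - C = {a + t |t. Poly_Mapping.keys t \<subseteq> e}"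
  obtains p1 q where "p = p1 + Poly_Mapping.single a 1 * q" "p1 \<in> monomial_span C"
    "\<And>m. m \<in> Poly_Mapping.keys q \<Longrightarrow> a + m \<in> Poly_Mapping.keys p"
proof -
  define q where "q = (\<Sum>k\<in>Poly_Mapping.keys p - C. Poly_Mapping.single (k - a) (Poly_Mapping.lookup p k))"
  define p1 where "p1 = (\<Sum>k\<in>Poly_Mapping.keys p \<inter> C. Poly_Mapping.single k (Poly_Mapping.lookup p k))"
  have ak: "a + (k - a) = k" if "k \<in> Poly_Mapping.keys p - C" for k
  proof -
    have "k \<in> D - C" using that monomial_spanD[OF p] by blast
    then obtain t where "k = a + t" using D by blast
    then show ?thesis by simp
  qed
  have "Poly_Mapping.single a 1 * q = (\<Sum>k\<in>Poly_Mapping.keys p - C. Poly_Mapping.single k (Poly_Mapping.lookup p k))"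
    unfolding q_def sum_distrib_left by (rule sum.cong[OF refl]) (simp add: mult_single ak)
  moreover have "p = (\<Sum>k\<in>Poly_Mapping.keys p \<inter> C. Poly_Mapping.single k (Poly_Mapping.lookup p k))
      + (\<Sum>k\<in>Poly_Mapping.keys p - C. Poly_Mapping.single k (Poly_Mapping.lookup p k))"
    by (subst poly_mapping_eq_sum_single) (rule sum.Int_Diff, simp)
  ultimately have "p = p1 + Poly_Mapping.single a 1 * q" by (simp add: p1_def)
  moreover have "p1 \<in> monomial_span C"
  proof -
    have "Poly_Mapping.keys p1 \<subseteq> (\<Union>k\<in>Poly_Mapping.keys p \<inter> C. Poly_Mapping.keys (Poly_Mapping.single k (Poly_Mapping.lookup p k)))"
      unfolding p1_def by (rule keys_sum)
    then show ?thesis by (auto simp: monomial_span_def split: if_splits)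
  qed
  moreover have "a + m \<in> Poly_Mapping.keys p" if m: "m \<in> Poly_Mapping.keys q" for m
  proof -
    have "Poly_Mapping.keys q \<subseteq> (\<Union>k\<in>Poly_Mapping.keys p - C. Poly_Mapping.keys (Poly_Mapping.single (k - a) (Poly_Mapping.lookup p k)))"
      unfolding q_def by (rule keys_sum)
    then obtain k where k: "k \<in> Poly_Mapping.keys p - C" "m = k - a" using m by (auto split: if_splits)
    then show ?thesis using ak[OF k(1)] by simp
  qed
  ultimately show ?thesis by (rule that)
qed

text \<open>Multiplication by the monomial of \<open>a\<close> maps \<open>S\<close> onto the
  factor. Its kernel is the prime of \<open>e\<close>, since \<open>a + m\<close> falls into
  \<open>C\<close> exactly when the support of \<open>m\<close> leaves \<open>e\<close>; degrees
  shift by \<open>a\<close>.\<close>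

lemma translate_factor_isomorphic:
  assumes AC: "A \<subseteq> C" and CD: "C \<subseteq> D" and DB: "D \<subseteq> B"
    and Cup: "\<And>m t. m \<in> C \<Longrightarrow> m + t \<in> C" and Dup: "\<And>m t. m \<in> D \<Longrightarrow> m + t \<in> D"
    and diff: "D - C = {a + t |t. Poly_Mapping.keys t \<subseteq> e}"
  shows "multigraded_isomorphic
    (quotient_module (Q\<lparr>carrier := cls_span D\<rparr>) (cls_span C))
    (quotient_grading (Q\<lparr>carrier := cls_span D\<rparr>) (restrict_grading gr (cls_span D)) (cls_span C))
    (quotient_module (self_module mpoly_ring) (monomial_prime e))
    (shift_grading (Poly_Mapping.lookup a)
      (quotient_grading (self_module mpoly_ring) mpoly_grading (monomial_prime e)))"
proof -
  let ?D = "Q\<lparr>carrier := cls_span D\<rparr>"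
  let ?L = "quotient_module ?D (cls_span C)"
  let ?S = "self_module mpoly_ring :: (('n, 'k) mpoly, ('n, 'k) mpoly) module"
  let ?P = "monomial_prime e :: ('n, 'k) mpoly set"
  let ?xa = "Poly_Mapping.single a (1::'k)"
  have CB: "C \<subseteq> B" using CD DB by blast
  have AD: "A \<subseteq> D" using AC CD by blast
  have DU: "p \<in> U" if "p \<in> monomial_span D" for p using that span_subset_U[OF DB] by blast
  have subD: "submodule (cls_span D) mpoly_ring Q" by (rule submodule_cls_span[OF DB Dup])
  interpret D: module mpoly_ring ?D by (rule submodule.submodule_is_module[OF subD Q.module_axioms])
  have subC: "submodule (cls_span C) mpoly_ring ?D"
    by (rule Q.submodule_restrict[OF subD submodule_cls_span[OF CB Cup]])
      (use monomial_span_mono[OF CD] in \<open>auto simp: cls_span_def\<close>)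
  interpret L: module mpoly_ring ?L by (rule D.quotient_module_is_module[OF subC])
  interpret S: module mpoly_ring ?S by (rule module_self_module)
  define \<theta> where "\<theta> q = cls_span C +>\<^bsub>?D\<^esub> cls (?xa * q)" for q
  have "0 \<in> {t :: 'n \<Rightarrow>\<^sub>0 nat. Poly_Mapping.keys t \<subseteq> e}" by simp
  then have aD: "a \<in> D" using diff by force
  have xaD: "?xa * q \<in> monomial_span D" for q
    using mult_mem_monomial_span[of D ?xa q] Dup aD by (simp add: mult.commute)
  have xaU: "?xa * q \<in> U" for q by (rule DU[OF xaD])
  have cD: "cls (?xa * q) \<in> carrier ?D" for q using xaD by (simp add: cls_span_def)
  have memC: "a + m \<in> C \<longleftrightarrow> \<not> Poly_Mapping.keys m \<subseteq> e" for m
  proof -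
    have "a + m \<in> D" by (rule Dup[OF aD])
    then have "a + m \<in> C \<longleftrightarrow> a + m \<notin> D - C" by blast
    also have "\<dots> \<longleftrightarrow> \<not> Poly_Mapping.keys m \<subseteq> e" unfolding diff by auto
    finally show ?thesis .
  qed
  have absorb: "cls_span C +>\<^bsub>?D\<^esub> cls (p1 + ?xa * q) = \<theta> q" if "p1 \<in> monomial_span C" for p1 q
  proof -
    have p1: "cls p1 \<in> cls_span C" "p1 \<in> U" using that span_subset_U[OF CB] by (auto simp: cls_span_def)
    have "cls (p1 + ?xa * q) = cls p1 \<oplus>\<^bsub>?D\<^esub> cls (?xa * q)" using cls_add[OF p1(2) xaU] by simp
    then show ?thesis using D.coset_absorb[OF subC cD p1(1)] by (simp only: \<theta>_def)
  qed
  have "\<exists>h\<in>module_iso mpoly_ring (quotient_module ?S ?P) ?L. \<forall>x\<in>carrier ?S. h (?P +>\<^bsub>?S\<^esub> x) = \<theta> x"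
  proof (rule first_isomorphism_theorem[OF S.module_axioms L.module_axioms])
    show "\<theta> x \<in> carrier ?L" for x using cD by (simp add: \<theta>_def D.carrier_quotient_module)
    show "\<theta> (x \<oplus>\<^bsub>?S\<^esub> y) = \<theta> x \<oplus>\<^bsub>?L\<^esub> \<theta> y" for x y
      using D.add_quotient_module[OF subC cD[of x] cD[of y]] cls_add[OF xaU xaU]
      by (simp add: \<theta>_def distrib_left)
    show "\<theta> (r \<odot>\<^bsub>?S\<^esub> x) = r \<odot>\<^bsub>?L\<^esub> \<theta> x" for r x
      using D.smult_quotient_module[OF subC _ cD[of x], of r] cls_smult[OF xaU, of r x]
      by (simp add: \<theta>_def mult.left_commute)
    show "submodule ?P mpoly_ring ?S" by (rule submodule_ideal[OF ideal_monomial_prime])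
    show "\<theta> x = \<zero>\<^bsub>?L\<^esub> \<longleftrightarrow> x \<in> ?P" for x
    proof -
      have "\<theta> x = \<zero>\<^bsub>?L\<^esub> \<longleftrightarrow> cls (?xa * x) \<in> cls_span C"
        unfolding \<theta>_def D.zero_quotient_module by (rule D.coset_eq_self_iff[OF subC cD])
      also have "\<dots> \<longleftrightarrow> ?xa * x \<in> monomial_span C" by (rule cls_mem_cls_span_iff[OF AC CB xaU])
      also have "\<dots> \<longleftrightarrow> x \<in> ?P"
        by (auto simp: monomial_prime_def monomial_span_def keys_monomial_mult memC)
      finally show ?thesis .
    qed
    show "\<theta> ` carrier ?S = carrier ?L"
    proof
      show "\<theta> ` carrier ?S \<subseteq> carrier ?L" using cD by (auto simp: \<theta>_def D.carrier_quotient_module)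
      show "carrier ?L \<subseteq> \<theta> ` carrier ?S"
      proof
        fix y assume "y \<in> carrier ?L"
        then obtain z where z: "z \<in> cls_span D" "y = cls_span C +>\<^bsub>?D\<^esub> z"
          by (auto simp: D.carrier_quotient_module)
        then obtain p where p: "p \<in> monomial_span D" "y = cls_span C +>\<^bsub>?D\<^esub> cls p"
          unfolding cls_span_def[of D] by blast
        obtain p1 q where "p = p1 + ?xa * q" "p1 \<in> monomial_span C"
          using split_off_translate[OF p(1) diff] by blast
        then have "y = \<theta> q" using absorb[of p1 q] p(2) by simp
        then show "y \<in> \<theta> ` carrier ?S" by simp
      qed
    qed
  qed
  then obtain h where h: "h \<in> module_iso mpoly_ring (quotient_module ?S ?P) ?L" "\<And>x. h (?P +>\<^bsub>?S\<^esub> x) = \<theta> x"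
    by auto
  interpret SP: module mpoly_ring "quotient_module ?S ?P"
    by (rule S.quotient_module_is_module[OF submodule_ideal[OF ideal_monomial_prime]])
  let ?H = "shift_grading (Poly_Mapping.lookup a) (quotient_grading ?S mpoly_grading ?P)"
  let ?G = "quotient_grading ?D (restrict_grading gr (cls_span D)) (cls_span C)"
  let ?g = "inv_into (carrier (quotient_module ?S ?P)) h"
  have H: "?H b = (\<lambda>x. ?P +>\<^bsub>?S\<^esub> x) ` mpoly_grading (\<lambda>i. b i - int (Poly_Mapping.lookup a i))" for b
    by (simp add: shift_grading_def quotient_grading_def)
  have G: "?G b = h ` ?H b" for b
  proof -
    have Gb: "?G b = (\<lambda>y. cls_span C +>\<^bsub>?D\<^esub> y) ` (cls ` (mpoly_grading b \<inter> U) \<inter> cls_span D)"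
      by (simp add: quotient_grading_def restrict_grading_def gr_eq)
    have Hb: "h ` ?H b = \<theta> ` mpoly_grading (\<lambda>i. b i - int (Poly_Mapping.lookup a i))"
      unfolding H image_image h(2) by simp
    show ?thesis unfolding Gb Hb
    proof (intro equalityI subsetI)
      fix y assume "y \<in> (\<lambda>y. cls_span C +>\<^bsub>?D\<^esub> y) ` (cls ` (mpoly_grading b \<inter> U) \<inter> cls_span D)"
      then obtain p where p: "p \<in> mpoly_grading b" "p \<in> U" "cls p \<in> cls_span D" "y = cls_span C +>\<^bsub>?D\<^esub> cls p"
        by auto
      have pD: "p \<in> monomial_span D" using cls_mem_cls_span_iff[OF AD DB p(2)] p(3) by blast
      obtain p1 q where pq: "p = p1 + ?xa * q" "p1 \<in> monomial_span C"
        "\<And>m. m \<in> Poly_Mapping.keys q \<Longrightarrow> a + m \<in> Poly_Mapping.keys p"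
        using split_off_translate[OF pD diff] by blast
      have "q \<in> mpoly_grading (\<lambda>i. b i - int (Poly_Mapping.lookup a i))"
        unfolding mpoly_grading_def
      proof (intro CollectI ballI allI)
        fix m i assume "m \<in> Poly_Mapping.keys q"
        then have "int (Poly_Mapping.lookup (a + m) i) = b i" using pq(3) p(1) unfolding mpoly_grading_def by blast
        then show "int (Poly_Mapping.lookup m i) = b i - int (Poly_Mapping.lookup a i)" by (simp add: lookup_add)
      qed
      moreover have "y = \<theta> q" using absorb[OF pq(2)] p(4) pq(1) by simp
      ultimately show "y \<in> \<theta> ` mpoly_grading (\<lambda>i. b i - int (Poly_Mapping.lookup a i))" by blast
    next
      fix y assume "y \<in> \<theta> ` mpoly_grading (\<lambda>i. b i - int (Poly_Mapping.lookup a i))"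
      then obtain q where q: "q \<in> mpoly_grading (\<lambda>i. b i - int (Poly_Mapping.lookup a i))" "y = \<theta> q" by blast
      have "?xa * q \<in> mpoly_grading b"
        using q(1) by (simp add: mpoly_grading_def keys_monomial_mult lookup_add)
      then have "cls (?xa * q) \<in> cls ` (mpoly_grading b \<inter> U) \<inter> cls_span D" using xaU xaD by (simp add: cls_span_def)
      then show "y \<in> (\<lambda>y. cls_span C +>\<^bsub>?D\<^esub> y) ` (cls ` (mpoly_grading b \<inter> U) \<inter> cls_span D)"
        unfolding q(2) \<theta>_def by (rule imageI)
    qed
  qed
  have inj: "inj_on h (carrier (quotient_module ?S ?P))" using h(1) by (simp add: module_iso_def bij_betw_def)
  have "?H b \<subseteq> carrier (quotient_module ?S ?P)" for b
    unfolding H S.carrier_quotient_module by (rule image_mono) simp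
  then have "?g ` ?G b = ?H b" for b unfolding G by (rule inv_into_image_cancel[OF inj])
  moreover have "?g \<in> module_iso mpoly_ring ?L (quotient_module ?S ?P)"
    by (rule module_iso_inverse[OF SP.module_axioms L.module_axioms h(1)])
  ultimately show ?thesis unfolding multigraded_isomorphic_def by blast
qed

lemma clean_of_exponent_chain:
  fixes r :: nat
  assumes C0: "C 0 = A" and Cr: "C r = B"
    and up: "\<And>i m t. i \<le> r \<Longrightarrow> m \<in> C i \<Longrightarrow> m + t \<in> C i"
    and sub: "\<And>i. i \<in> {1..r} \<Longrightarrow> C (i - 1) \<subseteq> C i"
    and diff: "\<And>i. i \<in> {1..r} \<Longrightarrow> C i - C (i - 1) = {a i + t |t. Poly_Mapping.keys t \<subseteq> e i}"
    and supp: "monomial_prime ` e ` {1..r} = min_primes mpoly_ring Q"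
  shows "clean Q gr"
proof -
  have mono: "C i \<subseteq> C j" if "i \<le> j" "j \<le> r" for i j
    using that
  proof (induction j rule: dec_induct)
    case (step n)
    then show ?case using sub[of "Suc n"] by auto
  qed simp
  have AC: "A \<subseteq> C i" and CB: "C i \<subseteq> B" if "i \<le> r" for i
    using mono[of 0 i] mono[of i r] that by (simp_all add: C0 Cr)
  have "prime_filtration Q gr r (\<lambda>i. cls_span (C i)) (\<lambda>i. monomial_prime (e i)) (\<lambda>i. Poly_Mapping.lookup (a i))"
    unfolding prime_filtration_def
  proof (intro conjI allI impI ballI)
    have "cls p = \<zero>\<^bsub>Q\<^esub>" if "p \<in> monomial_span A" for p
      using cls_eq_zero_iff[of p] that IU by (auto simp: I_def)
    moreover have "\<zero>\<^bsub>Q\<^esub> \<in> cls ` monomial_span A" unfolding cls_zero[symmetric] by (rule imageI) simp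
    ultimately show "cls_span (C 0) = {\<zero>\<^bsub>Q\<^esub>}" by (auto simp: C0 cls_span_def)
    show "cls_span (C r) = carrier Q" by (simp only: Cr cls_span_def carrier_Q U_def[symmetric])
    show "multigraded_submodule Q gr (cls_span (C i))" if "i \<le> r" for i
      by (rule multigraded_submodule_cls_span[OF CB[OF that] up[OF that]])
    fix i assume i: "i \<in> {1..r}"
    then have le: "i \<le> r" "i - 1 \<le> r" by auto
    show "monomial_ideal (monomial_prime (e i) :: ('n, 'k) mpoly set)" by (rule monomial_ideal_monomial_prime)
    show "primeideal (monomial_prime (e i) :: ('n, 'k) mpoly set) mpoly_ring" by (rule primeideal_monomial_prime)
    \<comment> \<open>The choice \<open>t = 0\<close> shows that \<open>a i\<close> itself is new,
      which makes the inclusion strict.\<close>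
    have "a i + 0 \<in> C i - C (i - 1)" unfolding diff[OF i] by (intro CollectI exI[of _ 0]) simp
    then have ai: "a i \<in> C i" "a i \<notin> C (i - 1)" by simp_all
    then have "Poly_Mapping.single (a i) 1 \<in> U" using CB[OF le(1)] by (auto simp: U_def)
    then have "cls (Poly_Mapping.single (a i) 1) \<notin> cls_span (C (i - 1))"
      using cls_mem_cls_span_iff[OF AC[OF le(2)] CB[OF le(2)]] ai(2) by simp
    moreover have "cls (Poly_Mapping.single (a i) 1) \<in> cls_span (C i)" using ai(1) by (simp add: cls_span_def)
    moreover have "cls_span (C (i - 1)) \<subseteq> cls_span (C i)"
      unfolding cls_span_def by (rule image_mono[OF monomial_span_mono[OF sub[OF i]]])
    ultimately show "cls_span (C (i - 1)) \<subset> cls_span (C i)" by blast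
    show "multigraded_isomorphic
      (quotient_module (Q\<lparr>carrier := cls_span (C i)\<rparr>) (cls_span (C (i - 1))))
      (quotient_grading (Q\<lparr>carrier := cls_span (C i)\<rparr>) (restrict_grading gr (cls_span (C i))) (cls_span (C (i - 1))))
      (quotient_module (self_module mpoly_ring) (monomial_prime (e i)))
      (shift_grading (Poly_Mapping.lookup (a i))
        (quotient_grading (self_module mpoly_ring) mpoly_grading (monomial_prime (e i))))"
      by (rule translate_factor_isomorphic[OF AC[OF le(2)] sub[OF i] CB[OF le(1)] up[OF le(2)] up[OF le(1)] diff[OF i]])
  qed
  moreover have "(\<lambda>i. monomial_prime (e i)) ` {1..r} = min_primes mpoly_ring Q" using supp by (simp add: image_image)
  ultimately show ?thesis unfolding clean_def by blast
qed

end

lemma (in depth_two_pair) clean_quotient: "clean Q gr"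
proof -
  have "\<exists>(r::nat) C e a. C 0 = A \<and> C r = residual {} \<and> e ` {1..r} = edges - {} \<and>
    (\<forall>i\<le>r. \<forall>m\<in>C i. \<forall>t. m + t \<in> C i) \<and>
    (\<forall>i\<in>{1..r}. C (i - 1) \<subseteq> C i \<and> C i - C (i - 1) = {a i + t |t. Poly_Mapping.keys t \<subseteq> e i})"
    by (rule residual_chain) simp
  then obtain r :: nat and C e a where C: "C 0 = A" "C r = residual {}" "e ` {1..r} = edges - {}"
    "\<forall>i\<le>r. \<forall>m\<in>C i. \<forall>t. m + t \<in> C i"
    "\<forall>i\<in>{1..r}. C (i - 1) \<subseteq> C i \<and> C i - C (i - 1) = {a i + t |t. Poly_Mapping.keys t \<subseteq> e i}"
    by (elim exE conjE)
  show ?thesis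
  proof (rule clean_of_exponent_chain)
    show "C 0 = A" by (rule C(1))
    show "C r = B" using C(2) AB by (auto simp: residual_def)
    show "monomial_prime ` e ` {1..r} = min_primes mpoly_ring Q" using C(3) min_primes_eq by simp
    show "m + t \<in> C i" if "i \<le> r" "m \<in> C i" for i m t using C(4) that by simp
    show "C (i - 1) \<subseteq> C i" if "i \<in> {1..r}" for i using C(5) that by simp
    show "C i - C (i - 1) = {a i + t |t. Poly_Mapping.keys t \<subseteq> e i}" if "i \<in> {1..r}" for i using C(5) that by simp
  qed
qed

theorem theorem1p7:
  fixes I U :: "('n::finite, 'k::field) mpoly set"
  assumes "CARD('n) > 2"
    and "monomial_ideal I" and "monomial_ideal U" and "I \<subset> U"
    and "cohen_macaulay (ideal_quotient_module U I)"
    and "module_dim mpoly_ring (ideal_quotient_module U I) = 2"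
    and "radical_ideal mpoly_ring I"
  shows "clean (ideal_quotient_module U I) (ideal_quotient_grading U I)"
proof -
  obtain A where A: "I = monomial_span A" "\<And>m t. m \<in> A \<Longrightarrow> m + t \<in> A" using monomial_idealE[OF assms(2)] by blast
  obtain B where B: "U = monomial_span B" "\<And>m t. m \<in> B \<Longrightarrow> m + t \<in> B" using monomial_idealE[OF assms(3)] by blast
  interpret monomial_pair A B I U
  proof
    show "A \<subseteq> B"
    proof
      fix m assume "m \<in> A"
      then have "Poly_Mapping.single m 1 \<in> U" using assms(4) A(1) by auto
      then show "m \<in> B" by (simp add: B(1))
    qed
    show "m' \<in> A" if "m \<in> A" "Poly_Mapping.keys m \<subseteq> Poly_Mapping.keys m'" for m m'
      by (rule radical_monomial_span_keys[OF A(2) _ that]) (use assms(7) A(1) in simp_all)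
  qed (fact A B)+
  interpret depth_two_pair A B I U
    by (rule depth_two_pair.intro[OF monomial_pair_axioms depth_two_exponents[OF assms(5,6)]])
  show ?thesis by (rule clean_quotient)
qed

end
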